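(* Suppose $C$ is a copula with unit Sobolev norm, i.e. $\|C\|=1$. Then there exists a unique invertible Borel measurable function $f\colon[0,1]\to[0,1]$ such that $f$ is measure-preserving and for almost every $(x,y)$ in $[0,1]^2$ $$\partial_1 C(x,y)=\begin{cases}1 & \text{if } y>f(x)\\ 0 & \text{if } y<f(x)\end{cases}\qquad\text{and}\qquad \partial_2 C(x,y)=\begin{cases}1 & \text{if } x>f^{-1}(y)\\ 0 & \text{if } x<f^{-1}(y).\end{cases}$$ Furthermore, if $f$ is continuous on an interval $I$, then it is differentiable on $I$ with constant derivative equal to either $1$ or $-1$.
   Context: A (bivariate) copula is a function $C\colon[0,1]^2\to[0,1]$ with $C(u,0)=0=C(0,v)$, $C(u,1)=u$, $C(1,v)=v$ and $C(u,v)-C(u,y)-C(x,v)+C(x,y)\ge 0$ for all $(u,v),(x,y)\in[0,1]^2$ with $x\le u$, $y\le v$. The partial derivatives $\partial_1C$ and $\partial_2C$ (with respect to the first and second variable) exist almost everywhere on $[0,1]^2$. The Sobolev norm of $C$ is defined by $\|C\|^2=\int_0^1\int_0^1\big((\partial_1C(x,y))^2+(\partial_2C(x,y))^2\big)\,dx\,dy$. A measurable function $\phi\colon[0,1]\to[0,1]$ is measure-preserving if $m(\phi^{-1}(B))=m(B)$ for every Lebesgue measurable set $B\subseteq[0,1]$, where $m$ is Lebesgue measure. Here $f^{-1}$ denotes the inverse of the invertible function $f$.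
   Formalization: Uniqueness of f is proved up to equality almost everywhere on [0,1]; literal uniqueness is false, since swapping the values of f at two points gives another invertible Borel measure-preserving function satisfying the same almost-everywhere formulas. *)

theory Defs
  imports "HOL-Analysis.Analysis"
begin

text \<open>Only the values of a function on the unit interval (square) are relevant; HOL functions are
  total, and their values elsewhere are unconstrained.\<close>

definition copula :: "(real \<Rightarrow> real \<Rightarrow> real) \<Rightarrow> bool" where
  "copula C \<longleftrightarrow>
     (\<forall>u\<in>{0..1}. \<forall>v\<in>{0..1}. C u v \<in> {0..1}) \<and>
     (\<forall>u\<in>{0..1}. C u 0 = 0 \<and> C u 1 = u) \<and>
     (\<forall>v\<in>{0..1}. C 0 v = 0 \<and> C 1 v = v) \<and>
     (\<forall>u\<in>{0..1}. \<forall>v\<in>{0..1}. \<forall>x\<in>{0..1}. \<forall>y\<in>{0..1}.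
        x \<le> u \<longrightarrow> y \<le> v \<longrightarrow> C u v - C u y - C x v + C x y \<ge> 0)"

text \<open>The derivatives are taken relative to \<open>[0,1]\<close>, hence one-sided on the boundary. The value at a
  point where the derivative does not exist is unspecified; for a copula this concerns a null set
  only.\<close>

definition partial1 :: "(real \<Rightarrow> real \<Rightarrow> real) \<Rightarrow> real \<Rightarrow> real \<Rightarrow> real" where
  "partial1 C x y = vector_derivative (\<lambda>u. C u y) (at x within {0..1})"

definition partial2 :: "(real \<Rightarrow> real \<Rightarrow> real) \<Rightarrow> real \<Rightarrow> real \<Rightarrow> real" where
  "partial2 C x y = vector_derivative (\<lambda>v. C x v) (at y within {0..1})"

definition sobolev_norm :: "(real \<Rightarrow> real \<Rightarrow> real) \<Rightarrow> real" where
  "sobolev_norm C =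
     sqrt (LBINT y:{0..1}. (LBINT x:{0..1}. (partial1 C x y)\<^sup>2 + (partial2 C x y)\<^sup>2))"

text \<open>The measurability condition says that preimages of Lebesgue measurable subsets of \<open>[0,1]\<close> are
  again Lebesgue measurable, so that their measure in the second condition is meaningful.\<close>

definition measure_preserving :: "(real \<Rightarrow> real) \<Rightarrow> bool" where
  "measure_preserving \<phi> \<longleftrightarrow>
     \<phi> \<in> lebesgue_on {0..1} \<rightarrow>\<^sub>M lebesgue_on {0..1} \<and>
     (\<forall>B. B \<in> sets lebesgue \<and> B \<subseteq> {0..1} \<longrightarrow>
        emeasure lebesgue (\<phi> -` B \<inter> {0..1}) = emeasure lebesgue B)"

text \<open>Stating the two case distinctions with \<open>has_real_derivative\<close> says that the partial derivative
  exists and has the given value. The inverse of \<open>f\<close> as a bijection of \<open>[0,1]\<close> is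
  \<open>inv_into {0..1} f\<close>.\<close>

definition represents :: "(real \<Rightarrow> real) \<Rightarrow> (real \<Rightarrow> real \<Rightarrow> real) \<Rightarrow> bool" where
  "represents f C \<longleftrightarrow>
     bij_betw f {0..1} {0..1} \<and>
     f \<in> borel_measurable (restrict_space borel {0..1}) \<and>
     measure_preserving f \<and>
     (AE (x, y) in lebesgue_on ({0..1} \<times> {0..1}).
        (y > f x \<longrightarrow> ((\<lambda>u. C u y) has_real_derivative 1) (at x within {0..1})) \<and>
        (y < f x \<longrightarrow> ((\<lambda>u. C u y) has_real_derivative 0) (at x within {0..1})) \<and>
        (x > inv_into {0..1} f y \<longrightarrow> ((\<lambda>v. C x v) has_real_derivative 1) (at y within {0..1})) \<and>
        (x < inv_into {0..1} f y \<longrightarrow> ((\<lambda>v. C x v) has_real_derivative 0) (at y within {0..1})))"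

end

theory Submission
  imports Defs "HOL-Probability.Probability_Measure"
begin

text \<open>For fixed \<open>y\<close> the section \<open>C(\<cdot>, y)\<close> has all its slopes in \<open>[0, 1]\<close>, so by a Vitali covering argument it is
differentiable almost everywhere (\<open>slope_gap_null\<close>), its derivative lies in \<open>[0, 1]\<close> and integrates to \<open>y\<close>;
symmetrically in the other variable. Hence the integrals of the two partial derivatives over the square are \<open>1/2\<close> each, and since \<open>t\<^sup>2 \<le> t\<close> on \<open>[0, 1]\<close> the squared norm is at most
\<open>1\<close>, with equality only if both derivatives take values in \<open>{0, 1}\<close> almost everywhere
(\<open>unit_norm_imp_zero_one_derivatives\<close>).

Because \<open>C\<close> is 2-increasing, the derivative in \<open>x\<close> is nondecreasing in \<open>y\<close>. A nondecreasing function with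
values in \<open>{0, 1}\<close> jumps once, and the place \<open>f(x)\<close> of the jump (\<open>threshold\<close>) is the measure of the set
where the function vanishes. Integrating back gives \<open>C(x, y) = m {s \<le> x. f(s) \<le> y}\<close>: the copula is the
distribution function of \<open>(id, f)\<close> under Lebesgue measure (\<open>measure_threshold\<close>). The same argument with the
roles of the variables exchanged yields \<open>g\<close> such that \<open>C\<close> is the distribution function of \<open>(g, id)\<close>.
So these two pairs have the same law (\<open>graph_law_eq\<close>). This one identity says that \<open>f\<close> and \<open>g\<close> preserve
Lebesgue measure (look at the marginals) and that \<open>g \<circ> f\<close> and \<open>f \<circ> g\<close> are the identity almost everywhere
(look at the mass of the two graphs).

It remains to make \<open>f\<close> bijective everywhere and not just almost everywhere, without losing Borel
measurability. The sets where \<open>f\<close> and \<open>g\<close> fail to be inverse to each other are null, but may have different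
cardinality. They are enlarged by a null set that contains a Borel copy of \<open>[0, 1]\<close>; then each of
them embeds into the other, and a Borel version of the Schroeder-Bernstein argument matches them
(\<open>ae_inverse_to_borel_bijection\<close>).

Uniqueness holds since on the region between the graphs of two representing functions the derivative would have
to be \<open>0\<close> and \<open>1\<close> at once. On an interval where \<open>f\<close> is continuous, injectivity makes it map intervals onto
intervals, and by measure preservation onto intervals of the same length, so \<open>f\<close> is an isometry there
(\<open>measure_preserving_isometry\<close>) and hence affine of slope \<open>1\<close> or \<open>-1\<close>.\<close>

section \<open>Differentiability almost everywhere of functions with slopes in [0, 1]\<close>

lemma continuous_on_bounded_slope:
  fixes F :: "real \<Rightarrow> real"
  assumes F: "\<And>a b. a \<le> b \<Longrightarrow> 0 \<le> F b - F a \<and> F b - F a \<le> b - a"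
  shows "continuous_on A F"
proof (rule lipschitz_on_continuous_on, rule lipschitz_onI)
  fix x y :: real
  show "dist (F x) (F y) \<le> 1 * dist x y"
    using F[of x y] F[of y x] by (cases "x \<le> y") (auto simp: dist_real_def)
qed auto

text \<open>The Stieltjes measures of \<open>F\<close> and of \<open>x - F x\<close> add up to Lebesgue measure because they do so on intervals.
Two uses: either summand is dominated by Lebesgue measure, and an upper bound for the slopes of \<open>x - F x\<close> is a
lower bound for the slopes of \<open>F\<close>, so that upper bounds alone have to be proved.\<close>

lemma interval_measure_add_eq_lborel:
  fixes F :: "real \<Rightarrow> real"
  assumes F: "\<And>a b. a \<le> b \<Longrightarrow> 0 \<le> F b - F a \<and> F b - F a \<le> b - a"
    and A: "A \<in> sets borel"
  shows "emeasure (interval_measure F) A + emeasure (interval_measure (\<lambda>x. x - F x)) A = emeasure lborel A"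
proof -
  have cont: "continuous_on UNIV F"
    by (rule continuous_on_bounded_slope[OF F])
  have cont': "continuous_on UNIV (\<lambda>x. x - F x)"
    by (intro continuous_intros cont)
  define \<mu> where "\<mu> = interval_measure F"
  define \<nu> where "\<nu> = interval_measure (\<lambda>x. x - F x)"
  have [simp]: "sets \<mu> = sets borel" "sets \<nu> = sets borel"
    by (auto simp: \<mu>_def \<nu>_def)
  have box: "emeasure (interval_measure G) (box l u) = ennreal (G u - G l)"
    if "continuous_on UNIV G" "l \<le> u" "\<And>x y. x \<le> y \<Longrightarrow> G x \<le> G y" for G :: "real \<Rightarrow> real" and l u :: real
  proof (cases "l = u")
    case False
    have r: "continuous (at_right a) G" for a
      using that(1) by (simp add: continuous_on_eq_continuous_at continuous_at_imp_continuous_at_within)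
    have s: "emeasure (interval_measure G) {u} = 0"
      using emeasure_interval_measure_Icc[of u u G] that continuous_on_subset[OF that(1)]
      by (auto simp: ennreal_0)
    have "{l<..u} = box l u \<union> {u}" using that False by (auto simp: box_real)
    then have "emeasure (interval_measure G) {l<..u} = emeasure (interval_measure G) (box l u) + emeasure (interval_measure G) {u}"
      by (simp add: plus_emeasure box_real)
    with emeasure_interval_measure_Ioc[of l u G, OF that(2) that(3) r] s show ?thesis by auto
  qed auto
  define M where "M = measure_of UNIV (sets borel) (\<lambda>A. emeasure \<mu> A + emeasure \<nu> A)"
  have sM[simp]: "sets M = sets borel"
    unfolding M_def using sigma_algebra.sigma_sets_eq[OF sets.sigma_algebra_axioms, of "borel::real measure"] by (simp add: sets_measure_of_conv)
  have em: "emeasure M A = emeasure \<mu> A + emeasure \<nu> A" if "A \<in> sets borel" for A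
  proof (rule emeasure_measure_of[OF M_def])
    show "countably_additive (sets M) (\<lambda>A. emeasure \<mu> A + emeasure \<nu> A)"
      by (rule countably_additiveI)
        (auto simp flip: suminf_add suminf_emeasure simp: suminf_add[OF summableI summableI, symmetric] image_subset_iff)
  qed (use that in \<open>auto simp: positive_def\<close>)
  have "lborel = M"
  proof (rule lborel_eqI)
    fix l u :: real assume "\<And>b. b \<in> Basis \<Longrightarrow> l \<bullet> b \<le> u \<bullet> b"
    then have lu: "l \<le> u" by auto
    have "emeasure M (box l u) = ennreal (F u - F l) + ennreal ((u - F u) - (l - F l))"
      unfolding em[OF borel_open[OF open_box]] \<mu>_def \<nu>_def
      using box[OF cont lu] box[OF cont' lu] F by force
    also have "\<dots> = ennreal (u - l)"
      using F[OF lu] by (subst ennreal_plus[symmetric]) auto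
    finally show "emeasure M (box l u) = ennreal (\<Prod>b\<in>Basis. (u - l) \<bullet> b)" by simp
  qed auto
  with em[OF A] show ?thesis by (simp add: \<mu>_def \<nu>_def)
qed

text \<open>Inside an open set barely larger than \<open>E\<close>, Vitali's theorem selects disjoint intervals of slope at most \<open>c\<close>
that cover almost all of \<open>E\<close>; the part left over has Stieltjes measure zero by domination.\<close>

lemma Vitali_slope_bound:
  fixes G :: "real \<Rightarrow> real"
  assumes G: "\<And>a b. a \<le> b \<Longrightarrow> 0 \<le> G b - G a \<and> G b - G a \<le> b - a"
    and E: "E \<in> sets borel" "emeasure lborel E < \<infinity>" and c: "0 \<le> c"
    and slope: "\<And>x d. x \<in> E \<Longrightarrow> 0 < d \<Longrightarrow>
       \<exists>a b. a < b \<and> x \<in> {a..b} \<and> b - a < d \<and> G b - G a \<le> c * (b - a)"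
  shows "emeasure (interval_measure G) E \<le> ennreal c * emeasure lborel E"
proof (rule ennreal_le_epsilon)
  fix e :: real assume e: "0 < e"
  define \<mu> where "\<mu> = interval_measure G"
  have le: "emeasure \<mu> A \<le> emeasure lborel A" if "A \<in> sets borel" for A
    using interval_measure_add_eq_lborel[OF G that] unfolding \<mu>_def
    by (metis add_increasing2 order_refl zero_le le_iff_add)
  have [simp]: "sets \<mu> = sets borel" by (auto simp: \<mu>_def)
  have cG: "continuous_on A G" for A
    by (rule continuous_on_bounded_slope[OF G])
  define e' where "e' = e / (c + 1)"
  have e': "e' > 0" "c * e' \<le> e" using e c by (auto simp: e'_def field_simps)
  obtain U where U: "open U" "E \<subseteq> U" "emeasure lborel (U - E) < ennreal e'"
  proof -
    obtain U where "open U" "E \<subseteq> U" "emeasure lebesgue (U - E) < ennreal e'"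
      using sets_lebesgue_outer_open[of E e'] E e' by (auto simp: ennreal_less_iff)
    then show ?thesis using that E by (auto simp: emeasure_completion) 
  qed
  have mU: "emeasure lborel U \<le> emeasure lborel E + ennreal e'"
  proof -
    have "emeasure lborel U = emeasure lborel E + emeasure lborel (U - E)"
      using U E by (subst plus_emeasure) (auto simp: Un_absorb1)
    then show ?thesis using U(3) by (metis add_left_mono less_imp_le)
  qed
  define K where "K = {(z, r). 0 < r \<and> cball z r \<subseteq> U \<and> G (z + r) - G (z - r) \<le> c * (2 * r)}"
  obtain C where C: "countable C" "C \<subseteq> K"
     "pairwise (\<lambda>i j. disjnt (cball (fst i) (snd i)) (cball (fst j) (snd j))) C"
     "negligible (E - (\<Union>i \<in> C. cball (fst i) (snd i)))"
  proof (rule Vitali_covering_theorem_cballs[of K snd E fst])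
    show "0 < snd i" if "i \<in> K" for i using that by (auto simp: K_def)
    fix x d :: real assume x: "x \<in> E" "0 < d"
    obtain \<delta> where \<delta>: "\<delta> > 0" "ball x \<delta> \<subseteq> U" using U x by (metis open_contains_ball subsetD)
    obtain a b where ab: "a < b" "x \<in> {a..b}" "b - a < min d \<delta>" "G b - G a \<le> c * (b - a)"
      using slope[OF x(1), of "min d \<delta>"] x \<delta> by auto
    define z r where "z = (a + b) / 2" and "r = (b - a) / 2"
    have zr: "z + r = b" "z - r = a" "2 * r = b - a" "0 < r"
      using ab by (auto simp: z_def r_def field_simps)
    have cb: "cball z r = {a..b}" by (simp add: cball_eq_atLeastAtMost zr)
    have "cball z r \<subseteq> ball x \<delta>" using ab unfolding cb by (auto simp: dist_real_def)
    with \<delta> ab zr have "(z, r) \<in> K"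
      unfolding K_def mem_Collect_eq prod.case zr by auto
    then show "\<exists>i. i \<in> K \<and> x \<in> cball (fst i) (snd i) \<and> snd i < d"
      by (intro exI[of _ "(z, r)"]) (use ab cb zr in auto)
  qed auto
  define B where "B = (\<lambda>i::real \<times> real. cball (fst i) (snd i))"
  have Bb[measurable]: "(\<Union>i\<in>C. B i) \<in> sets borel"
    using C(1) by (intro sets.countable_UN') (auto simp: B_def)
  have dis: "disjoint_family_on B C"
    using C(3) by (auto simp: B_def disjoint_family_on_def pairwise_def disjnt_def)
  have BU: "(\<Union>i\<in>C. B i) \<subseteq> U" using C(2) by (fastforce simp: K_def B_def)
  have Bi: "emeasure \<mu> (B i) \<le> ennreal c * emeasure lborel (B i)" if "i \<in> C" for i
  proof -
    obtain z r where i: "i = (z, r)" by (cases i)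
    then have zr: "0 < r" "G (z + r) - G (z - r) \<le> c * (2 * r)" using that C(2) by (auto simp: K_def)
    have "emeasure \<mu> {z - r..z + r} = ennreal (G (z + r) - G (z - r))"
      unfolding \<mu>_def by (rule emeasure_interval_measure_Icc) (use zr cG G in \<open>force+\<close>)
    also have "\<dots> \<le> ennreal (c * (2 * r))" using zr by (intro ennreal_leI)
    also have "\<dots> = ennreal c * ennreal (2 * r)" using c zr by (simp add: ennreal_mult)
    also have "\<dots> = ennreal c * emeasure lborel {z - r..z + r}" using zr by simp
    finally show ?thesis by (simp add: i B_def cball_eq_atLeastAtMost)
  qed
  have "emeasure \<mu> E \<le> emeasure \<mu> ((\<Union>i\<in>C. B i) \<union> (E - (\<Union>i\<in>C. B i)))"
    using E by (intro emeasure_mono) auto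
  also have "\<dots> \<le> emeasure \<mu> (\<Union>i\<in>C. B i) + emeasure \<mu> (E - (\<Union>i\<in>C. B i))"
    using E by (intro emeasure_subadditive) auto
  also have "emeasure \<mu> (E - (\<Union>i\<in>C. B i)) = 0"
  proof -
    have "emeasure lebesgue (E - (\<Union>i\<in>C. B i)) = 0"
      using C(4) unfolding B_def negligible_iff_null_sets by auto
    then have "emeasure lborel (E - (\<Union>i\<in>C. B i)) = 0" using E by (simp add: emeasure_completion)
    then show ?thesis using le[of "E - (\<Union>i\<in>C. B i)"] E by auto
  qed
  also have "emeasure \<mu> (\<Union>i\<in>C. B i) = (\<integral>\<^sup>+i. emeasure \<mu> (B i) \<partial>count_space C)"
    using C(1) dis by (intro emeasure_UN_countable) (auto simp: B_def)
  also have "\<dots> \<le> (\<integral>\<^sup>+i. ennreal c * emeasure lborel (B i) \<partial>count_space C)"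
    by (intro nn_integral_mono) (auto intro: Bi)
  also have "\<dots> = ennreal c * (\<integral>\<^sup>+i. emeasure lborel (B i) \<partial>count_space C)"
    by (rule nn_integral_cmult) auto
  also have "(\<integral>\<^sup>+i. emeasure lborel (B i) \<partial>count_space C) = emeasure lborel (\<Union>i\<in>C. B i)"
    using C(1) dis by (intro emeasure_UN_countable[symmetric]) (auto simp: B_def)
  also have "\<dots> \<le> emeasure lborel U" using U BU by (intro emeasure_mono) auto
  also note mU
  also have "ennreal c * (emeasure lborel E + ennreal e') + 0 \<le> ennreal c * emeasure lborel E + ennreal e"
    using e' c e by (auto simp: distrib_left ennreal_mult[symmetric] intro!: add_left_mono ennreal_leI)
  finally show "emeasure (interval_measure G) E \<le> ennreal c * emeasure lborel E + ennreal e"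
    by (simp add: \<mu>_def mult_left_mono add_right_mono)
qed

text \<open>The points at which the lower derivative is below \<open>p\<close> and the upper derivative above \<open>q\<close>, in a form that makes
Borel measurability visible: the intervals contain \<open>x\<close> in their interior and the inequalities are strict, so
that for each \<open>d\<close> the condition is open.\<close>

definition slope_gap :: "(real \<Rightarrow> real) \<Rightarrow> real \<Rightarrow> real \<Rightarrow> real set" where
  "slope_gap F p q = {x. \<forall>d>0.
     (\<exists>a b. a < x \<and> x < b \<and> b - a < d \<and> F b - F a < p * (b - a)) \<and>
     (\<exists>a b. a < x \<and> x < b \<and> b - a < d \<and> q * (b - a) < F b - F a)}"

text \<open>Measurability jointly in the point and in a parameter on which \<open>K\<close> depends continuously. Fubini's theorem will
be applied to these sets.\<close>

lemma slope_gap_borel_prod: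
  assumes K: "\<And>x. continuous_on UNIV (K x)"
  shows "{(x, y). x \<in> slope_gap (\<lambda>u. K u y) p q} \<in> sets (borel :: (real \<times> real) measure)"
proof -
  define L where "L n = (\<Union>a. \<Union>b\<in>{b. b - a < 1 / Suc n}. {a<..<b} \<times> {y. K b y - K a y < p * (b - a)})" for n
  define R where "R n = (\<Union>a. \<Union>b\<in>{b. b - a < 1 / Suc n}. {a<..<b} \<times> {y. q * (b - a) < K b y - K a y})" for n
  have o1: "open {y. K b y - K a y < p * (b - a)}" for a b
    by (intro open_Collect_less continuous_intros K)
  have o2: "open {y. q * (b - a) < K b y - K a y}" for a b
    by (intro open_Collect_less continuous_intros K)
  have "open (L n)" "open (R n)" for n
    unfolding L_def R_def by (intro open_UN ballI open_Times o1 o2 open_greaterThanLessThan)+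
  then have "(\<Inter>n. L n \<inter> R n) \<in> sets borel" by auto
  also have "(\<Inter>n. L n \<inter> R n) = {(x, y). x \<in> slope_gap (\<lambda>u. K u y) p q}"
  proof -
    have "(\<forall>n. (x, y) \<in> L n \<inter> R n) \<longleftrightarrow> x \<in> slope_gap (\<lambda>u. K u y) p q" for x y
    proof
      assume *: "\<forall>n. (x, y) \<in> L n \<inter> R n"
      show "x \<in> slope_gap (\<lambda>u. K u y) p q"
        unfolding slope_gap_def
      proof (intro CollectI allI impI)
        fix d :: real assume "0 < d"
        then obtain n where n: "1 / Suc n < d" by (metis nat_approx_posE)
        with * show "(\<exists>a b. a < x \<and> x < b \<and> b - a < d \<and> K b y - K a y < p * (b - a)) \<and>
           (\<exists>a b. a < x \<and> x < b \<and> b - a < d \<and> q * (b - a) < K b y - K a y)"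
          unfolding L_def R_def by (fastforce dest: spec[of _ n])
      qed
    next
      assume *: "x \<in> slope_gap (\<lambda>u. K u y) p q"
      have "\<exists>a b. a < x \<and> x < b \<and> b - a < 1 / Suc n \<and> K b y - K a y < p * (b - a)"
           "\<exists>a b. a < x \<and> x < b \<and> b - a < 1 / Suc n \<and> q * (b - a) < K b y - K a y" for n
        using * unfolding slope_gap_def by (auto dest!: spec[of _ "1 / Suc n"])
      then show "\<forall>n. (x, y) \<in> L n \<inter> R n"
        unfolding L_def R_def by fastforce
    qed
    then show ?thesis by auto
  qed
  finally show ?thesis .
qed

lemma slope_gap_borel: "slope_gap F p q \<in> sets borel"
proof -
  have "{(x, y). x \<in> slope_gap F p q} \<in> sets ((borel :: real measure) \<Otimes>\<^sub>M (borel :: real measure))"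
    using slope_gap_borel_prod[of "\<lambda>x y. F x" p q] by (simp only: borel_prod continuous_on_const)
  from sets_Pair2[OF this, of 0] show ?thesis by (simp add: vimage_def)
qed

text \<open>On a bounded part \<open>E\<close> of the set, the slope bound for \<open>F\<close> gives Stieltjes measure at most \<open>p m(E)\<close>, and the one
for \<open>x - F x\<close> gives at most \<open>(1 - q) m(E)\<close>. The two measures sum to \<open>m(E)\<close>, so \<open>(q - p) m(E) \<le> 0\<close>.\<close>

lemma slope_gap_null:
  fixes F :: "real \<Rightarrow> real"
  assumes F: "\<And>a b. a \<le> b \<Longrightarrow> 0 \<le> F b - F a \<and> F b - F a \<le> b - a"
    and "p < q"
  shows "slope_gap F p q \<in> null_sets lborel"
proof (cases "slope_gap F p q = {}")
  case False
  then obtain x where x: "x \<in> slope_gap F p q" by auto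
  have pq: "0 \<le> p" "q \<le> 1"
  proof -
    obtain a b where "a < x" "x < b" "F b - F a < p * (b - a)"
      using x zero_less_one unfolding slope_gap_def mem_Collect_eq by meson
    then have "a < b" by simp
    with \<open>F b - F a < p * (b - a)\<close> F[of a b] have "0 < p * (b - a)" by auto
    with \<open>a < b\<close> show "0 \<le> p" by (simp add: zero_less_mult_iff)
    obtain a b where "a < x" "x < b" "q * (b - a) < F b - F a"
      using x zero_less_one unfolding slope_gap_def mem_Collect_eq by meson
    then have "a < b" by simp
    with \<open>q * (b - a) < F b - F a\<close> F[of a b, OF less_imp_le[OF \<open>a < b\<close>]] have "q * (b - a) < 1 * (b - a)"
      unfolding mult_1 by linarith
    with \<open>a < b\<close> show "q \<le> 1" by (simp only: mult_less_cancel_right) auto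
  qed
  have F': "0 \<le> (b - F b) - (a - F a) \<and> (b - F b) - (a - F a) \<le> b - a" if "a \<le> b" for a b
    using F[OF that] by auto
  have null: "slope_gap F p q \<inter> cball 0 (real n) \<in> null_sets lborel" (is "?E \<in> _") for n
  proof -
    have E[measurable]: "?E \<in> sets borel" using slope_gap_borel by auto
    have fin: "emeasure lborel ?E < \<infinity>"
      by (intro emeasure_bounded_finite) auto
    have 1: "emeasure (interval_measure F) ?E \<le> ennreal p * emeasure lborel ?E"
    proof (rule Vitali_slope_bound[OF F E fin pq(1)])
      fix x d :: real assume "x \<in> ?E" "0 < d"
      then obtain a b where "a < x" "x < b" "b - a < d" "F b - F a < p * (b - a)"
        unfolding slope_gap_def by auto
      then show "\<exists>a b. a < b \<and> x \<in> {a..b} \<and> b - a < d \<and> F b - F a \<le> p * (b - a)"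
        by (intro exI[of _ a] exI[of _ b]) auto
    qed
    have 2: "emeasure (interval_measure (\<lambda>x. x - F x)) ?E \<le> ennreal (1 - q) * emeasure lborel ?E"
    proof (rule Vitali_slope_bound[OF F' E fin])
      fix x d :: real assume "x \<in> ?E" "0 < d"
      then obtain a b where "a < x" "x < b" "b - a < d" "q * (b - a) < F b - F a"
        unfolding slope_gap_def by auto
      then show "\<exists>a b. a < b \<and> x \<in> {a..b} \<and> b - a < d \<and> (b - F b) - (a - F a) \<le> (1 - q) * (b - a)"
        by (intro exI[of _ a] exI[of _ b]) (auto simp: algebra_simps)
    qed (use pq in auto)
    obtain m where m: "emeasure lborel ?E = ennreal m" "0 \<le> m"
      using fin by (metis ennreal_cases infinity_ennreal_def less_irrefl)
    have "ennreal m \<le> ennreal (p * m) + ennreal ((1 - q) * m)"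
      using add_mono[OF 1 2] interval_measure_add_eq_lborel[OF F E] pq m
      by (simp add: ennreal_mult)
    also have "\<dots> = ennreal (p * m + (1 - q) * m)"
      using pq m by (intro ennreal_plus[symmetric]) auto
    finally have "m \<le> p * m + (1 - q) * m" using pq m by (simp add: ennreal_le_iff del: ennreal_plus)
    then have "(q - p) * m \<le> 0" by (simp add: algebra_simps)
    with \<open>p < q\<close> m have "m = 0" by (simp add: mult_le_0_iff)
    with m E show ?thesis by (auto simp: null_sets_def)
  qed
  have "slope_gap F p q = (\<Union>n. slope_gap F p q \<inter> cball 0 (real n))"
    by (auto simp: real_arch_simple)
  also have "\<dots> \<in> null_sets lborel" using null by (intro null_sets_UN) auto
  finally show ?thesis .
qed auto

text \<open>The candidate \<open>D\<close> is the supremum of the slopes \<open>q\<close> exceeded by arbitrarily short intervals around \<open>x\<close>. Since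
\<open>x\<close> lies in no slope gap, the slopes of all short intervals around \<open>x\<close> are close to \<open>D\<close>. Intervals that have
\<open>x\<close> as an endpoint are compared with slightly longer ones.\<close>

lemma differentiable_outside_slope_gaps:
  fixes F :: "real \<Rightarrow> real"
  assumes F: "\<And>a b. a \<le> b \<Longrightarrow> 0 \<le> F b - F a \<and> F b - F a \<le> b - a"
    and x: "\<And>p q. p \<in> \<rat> \<Longrightarrow> q \<in> \<rat> \<Longrightarrow> p < q \<Longrightarrow> x \<notin> slope_gap F p q"
  shows "\<exists>D. (F has_real_derivative D) (at x)"
proof -
  define steep where "steep q \<longleftrightarrow> (\<forall>d>0. \<exists>a b. a < x \<and> x < b \<and> b - a < d \<and> q * (b - a) < F b - F a)" for q
  define D where "D = Sup (Collect steep)"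
  have steep_neg: "steep q" if "q < 0" for q
    unfolding steep_def
  proof (intro allI impI)
    fix d :: real assume "0 < d"
    have "q * (2 * (d / 3)) < 0" using \<open>0 < d\<close> that by (simp add: mult_neg_pos)
    then show "\<exists>a b. a < x \<and> x < b \<and> b - a < d \<and> q * (b - a) < F b - F a"
      using F[of "x - d/3" "x + d/3"] \<open>0 < d\<close>
      by (intro exI[of _ "x - d/3"] exI[of _ "x + d/3"]) (auto simp: algebra_simps)
  qed
  have steep_le: "q < 1" if st: "steep q" for q
  proof -
    obtain a b where "a < x" "x < b" "q * (b - a) < F b - F a"
      using st zero_less_one unfolding steep_def by meson
    then have "a < b" by simp
    with \<open>q * (b - a) < F b - F a\<close> F[of a b, OF less_imp_le[OF \<open>a < b\<close>]] have "q * (b - a) < 1 * (b - a)"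
      unfolding mult_1 by linarith
    with \<open>a < b\<close> show "q < 1" by (simp only: mult_less_cancel_right)
  qed
  have bdd: "bdd_above (Collect steep)" using steep_le by (intro bdd_aboveI[of _ 1]) (auto intro: less_imp_le)
  have steep_mono: "steep p" if "steep q" "p \<le> q" for p q
    unfolding steep_def
  proof (intro allI impI)
    fix d :: real assume "0 < d"
    with that(1) obtain a b where ab: "a < x" "x < b" "b - a < d" "q * (b - a) < F b - F a"
      unfolding steep_def by blast
    with that(2) have "p * (b - a) \<le> q * (b - a)" by (intro mult_right_mono) auto
    with ab(4) have "p * (b - a) < F b - F a" by linarith
    with ab show "\<exists>a b. a < x \<and> x < b \<and> b - a < d \<and> p * (b - a) < F b - F a"
      by blast
  qed
  have D1: "D \<le> 1" unfolding D_def using steep_le steep_neg[of "-1"]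
    by (intro cSup_least) (auto intro: less_imp_le)
  have D0: "0 \<le> D"
  proof (rule ccontr)
    assume "\<not> 0 \<le> D"
    then have "steep (D / 2)" by (intro steep_neg) auto
    then have "D / 2 \<le> D" unfolding D_def by (intro cSup_upper bdd) auto
    with \<open>\<not> 0 \<le> D\<close> show False by auto
  qed
  have straddle: "\<exists>d>0. \<forall>a b. a < x \<and> x < b \<and> b - a < d \<longrightarrow> \<bar>F b - F a - D * (b - a)\<bar> \<le> e * (b - a)"
    if e: "0 < e" for e
  proof -
    obtain r where r: "D < r" "r < D + e" using dense[of D "D + e"] e by auto
    have "\<not> steep r" using r(1) cSup_upper[OF _ bdd, of r] unfolding D_def by auto
    then obtain d1 where d1: "d1 > 0" "\<And>a b. a < x \<Longrightarrow> x < b \<Longrightarrow> b - a < d1 \<Longrightarrow> F b - F a \<le> r * (b - a)"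
      unfolding steep_def by (meson not_le)
    obtain q where q: "q \<in> \<rat>" "D - e < q" "q < D" using Rats_dense_in_real[of "D - e" D] e by auto
    \<comment> \<open>Two rational numbers below \<open>D\<close> are needed: \<open>q\<close> is exceeded near \<open>x\<close>, so no gap from \<open>p\<close> to \<open>q\<close> forces
    slopes of at least \<open>p\<close>.\<close>
    obtain p where p: "p \<in> \<rat>" "D - e < p" "p < q" using Rats_dense_in_real[of "D - e" q] q by auto
    have "steep q"
    proof -
      obtain s where "steep s" "q < s"
        using q(3) steep_neg[of "-1"] unfolding D_def by (subst (asm) less_cSup_iff[OF _ bdd]) auto
      then show ?thesis using steep_mono by auto
    qed
    with x[OF p(1) q(1) p(3)] obtain d2 where d2: "d2 > 0"
      "\<And>a b. a < x \<Longrightarrow> x < b \<Longrightarrow> b - a < d2 \<Longrightarrow> p * (b - a) \<le> F b - F a"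
      unfolding steep_def slope_gap_def by (simp add: not_less) (meson not_less)
    show ?thesis
    proof (intro exI[of _ "min d1 d2"] conjI allI impI)
      fix a b assume ab: "a < x \<and> x < b \<and> b - a < min d1 d2"
      then have "F b - F a \<le> r * (b - a)" "p * (b - a) \<le> F b - F a" using d1(2) d2(2) by auto
      moreover have "r * (b - a) \<le> (D + e) * (b - a)" "(D - e) * (b - a) \<le> p * (b - a)"
        using r p ab by (auto intro!: mult_right_mono)
      ultimately show "\<bar>F b - F a - D * (b - a)\<bar> \<le> e * (b - a)"
        by (auto simp: algebra_simps abs_le_iff)
    qed (use d1 d2 in auto)
  qed
  have "(\<lambda>h. (F (x + h) - F x) / h) \<midarrow>0\<rightarrow> D"
  proof (rule LIM_I)
    fix \<epsilon> :: real assume \<epsilon>: "0 < \<epsilon>"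
    define e where "e = min 1 (\<epsilon> / 5)"
    have e: "0 < e" "e \<le> 1" "4 * e < \<epsilon>" using \<epsilon> by (auto simp: e_def min_def)
    obtain d where d: "d > 0" "\<And>a b. a < x \<Longrightarrow> x < b \<Longrightarrow> b - a < d \<Longrightarrow> \<bar>F b - F a - D * (b - a)\<bar> \<le> e * (b - a)"
      using straddle[OF e(1)] by metis
    have est: "\<bar>F (x + h) - F x - D * h\<bar> \<le> 4 * e * \<bar>h\<bar>" if h: "h \<noteq> 0" "\<bar>h\<bar> < d / 2" for h
    proof -
      \<comment> \<open>The interval between \<open>x\<close> and \<open>x + h\<close> is prolonged beyond \<open>x\<close> by the fraction \<open>e\<close> of its length.
      Each of the four errors that arise is at most \<open>k\<close>.\<close>
      define k where "k = e * \<bar>h\<bar>"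
      have k: "0 < k" "k \<le> \<bar>h\<bar>" "e * k \<le> k" "D * k \<le> k" "0 \<le> D * k"
        using e h D0 D1 by (auto simp: k_def mult_left_le_one_le)
      show ?thesis
      proof (cases "h > 0")
        case True
        have "\<bar>F (x + h) - F (x - k) - D * (x + h - (x - k))\<bar> \<le> e * (x + h - (x - k))"
          using True h k by (intro d(2)) auto
        moreover have "D * (x + h - (x - k)) = D * h + D * k" "e * (x + h - (x - k)) = k + e * k"
          using True by (auto simp: algebra_simps k_def)
        moreover have "0 \<le> F x - F (x - k)" "F x - F (x - k) \<le> k" "4 * e * \<bar>h\<bar> = 4 * k"
          using F[of "x - k" x] k by (auto simp: k_def)
        ultimately show ?thesis using k by linarith
      next
        case False
        have "\<bar>F (x + k) - F (x + h) - D * (x + k - (x + h))\<bar> \<le> e * (x + k - (x + h))"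
          using False h k by (intro d(2)) auto
        moreover have "D * (x + k - (x + h)) = D * k - D * h" "e * (x + k - (x + h)) = k + e * k"
          using False h by (auto simp: algebra_simps k_def)
        moreover have "0 \<le> F (x + k) - F x" "F (x + k) - F x \<le> k" "4 * e * \<bar>h\<bar> = 4 * k"
          using F[of x "x + k"] k by (auto simp: k_def)
        ultimately show ?thesis using k by linarith
      qed
    qed
    show "\<exists>s>0. \<forall>h. h \<noteq> 0 \<and> norm (h - 0) < s \<longrightarrow> norm ((F (x + h) - F x) / h - D) < \<epsilon>"
    proof (intro exI[of _ "d / 2"] conjI allI impI)
      fix h :: real assume h: "h \<noteq> 0 \<and> norm (h - 0) < d / 2"
      have "norm ((F (x + h) - F x) / h - D) = \<bar>F (x + h) - F x - D * h\<bar> / \<bar>h\<bar>"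
        using h by (simp add: abs_divide[symmetric] diff_divide_distrib)
      also have "\<dots> \<le> 4 * e" using est[of h] h by (simp add: divide_le_eq)
      finally show "norm ((F (x + h) - F x) / h - D) < \<epsilon>" using e by simp
    qed (use d in auto)
  qed
  then show ?thesis by (auto simp: DERIV_def)
qed

lemma tendsto_difference_quotient_seq:
  fixes f :: "real \<Rightarrow> real"
  assumes "(f has_real_derivative D) (at x)"
  shows "(\<lambda>n. (f (x + 1 / Suc n) - f x) * Suc n) \<longlonglongrightarrow> D"
proof -
  have "filterlim (\<lambda>n. 1 / real (Suc n)) (at 0) sequentially"
    using LIMSEQ_inverse_real_of_nat by (intro filterlim_atI) (auto simp: inverse_eq_divide)
  from filterlim_compose[OF assms[unfolded DERIV_def] this] show ?thesis by (simp del: of_nat_Suc)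
qed

text \<open>The difference quotients of step \<open>1/(n+1)\<close> are bounded by \<open>1\<close> and converge to the derivative. Their integrals
are difference quotients of a primitive of \<open>F\<close> and converge to \<open>F b - F a\<close>.\<close>

lemma integral_derivative_bounded_slope:
  fixes F D :: "real \<Rightarrow> real"
  assumes F: "\<And>a b. a \<le> b \<Longrightarrow> 0 \<le> F b - F a \<and> F b - F a \<le> b - a"
    and D[measurable]: "D \<in> borel_measurable borel"
    and deriv: "AE x in lborel. (F has_real_derivative D x) (at x)"
    and ab: "a \<le> b"
  shows "(LBINT x:{a..b}. D x) = F b - F a"
proof -
  have cF: "continuous_on A F" for A by (rule continuous_on_bounded_slope[OF F])
  have isF: "isCont F x" for x by (intro continuous_on_interior[OF cF[of UNIV]]) simp
  have [measurable]: "F \<in> borel_measurable borel" by (rule borel_measurable_continuous_onI[OF cF])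
  define Q where "Q n x = (F (x + 1 / Suc n) - F x) * Suc n" for n x
  have [measurable]: "Q n \<in> borel_measurable borel" for n unfolding Q_def by measurable
  have isQ: "isCont (Q n) x" for n x
    unfolding Q_def by (intro continuous_intros isCont_o2[OF _ isF] isF)
  obtain P where P: "\<And>x. (P has_real_derivative F x) (at x)"
    using einterval_antiderivative[of "-\<infinity>" "\<infinity>" F] isF
    by (auto simp: has_real_derivative_iff_has_vector_derivative)
  have "(\<lambda>n. LBINT x:{a..b}. Q n x) \<longlonglongrightarrow> (LBINT x:{a..b}. D x)"
    unfolding set_lebesgue_integral_def
  proof (rule integral_dominated_convergence[where w = "indicator {a..b}"])
    show "AE x in lborel. (\<lambda>n. indicator {a..b} x *\<^sub>R Q n x) \<longlonglongrightarrow> indicator {a..b} x *\<^sub>R D x"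
      using deriv unfolding Q_def
      by eventually_elim (intro tendsto_intros tendsto_difference_quotient_seq)
    fix n
    have "0 \<le> Q n x" "Q n x \<le> 1 / Suc n * Suc n" for x
      using F[of x "x + 1 / Suc n"] unfolding Q_def
      by (intro mult_nonneg_nonneg mult_right_mono; simp)+
    then show "AE x in lborel. norm (indicator {a..b} x *\<^sub>R Q n x) \<le> indicator {a..b} x"
      by (auto simp: indicator_def)
    show "integrable lborel (indicator {a..b} :: real \<Rightarrow> real)"
      using ab by (intro integrable_real_indicator) auto
  qed auto
  moreover have "(LBINT x:{a..b}. Q n x) = (P (b + 1 / Suc n) - P b) * Suc n - (P (a + 1 / Suc n) - P a) * Suc n" for n
  proof -
    have "(\<integral>x. Q n x * indicator {a..b} x \<partial>lborel) =
        (P (b + 1 / Suc n) - P b) * Suc n - (P (a + 1 / Suc n) - P a) * Suc n"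
    proof (rule integral_FTC_Icc_real[OF ab])
      fix x
      show "((\<lambda>x. (P (x + 1 / Suc n) - P x) * Suc n) has_real_derivative Q n x) (at x)"
        unfolding Q_def
        by (auto intro!: derivative_eq_intros DERIV_chain'[OF _ P] P)
    qed (rule isQ)
    then show ?thesis by (simp add: set_lebesgue_integral_def mult.commute)
  qed
  moreover have "(\<lambda>n. (P (b + 1 / Suc n) - P b) * Suc n - (P (a + 1 / Suc n) - P a) * Suc n) \<longlonglongrightarrow> F b - F a"
    by (intro tendsto_diff tendsto_difference_quotient_seq P)
  ultimately show ?thesis using LIMSEQ_unique by auto
qed

section \<open>Borel bijections that agree almost everywhere with a given map\<close>

text \<open>Every Borel set of positive measure contains a null set that is the image of a strictly increasing function.
Take a closed subset \<open>T\<close> of positive measure \<open>c\<close> and follow a pure jump function \<open>H\<close> with values in \<open>(0, c]\<close>: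
the point \<open>k t\<close> of \<open>T\<close> is chosen to have mass \<open>H t\<close> of \<open>T\<close> to its left. The function \<open>k\<close> then skips, at each
rational number, a piece of \<open>T\<close> whose mass is the height of the jump of \<open>H\<close>, and these pieces exhaust the
mass of \<open>T\<close>.\<close>

lemma strict_mono_into_null_subset:
  fixes A :: "real set"
  assumes A: "A \<in> sets borel" "A \<subseteq> {0..1}" "A \<notin> null_sets lborel"
  obtains k :: "real \<Rightarrow> real" and N where "strict_mono k" "range k \<subseteq> A \<inter> N" "N \<in> null_sets lborel"
proof -
  have A0: "emeasure lborel A \<noteq> 0" using A by (auto simp: null_sets_def)
  have A1: "emeasure lborel A \<le> 1"
    using emeasure_mono[of A "{0..1}" lborel] A by simp
  obtain m where m: "emeasure lborel A = ennreal m" "0 < m"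
  proof (rule that)
    have "emeasure lborel A \<noteq> \<infinity>" using A1 by (auto simp: top_unique)
    then show "emeasure lborel A = ennreal (measure lborel A)"
      by (simp add: emeasure_eq_ennreal_measure)
    with A0 show "0 < measure lborel A" by (auto simp: less_le)
  qed
  obtain T where T: "closed T" "T \<subseteq> A" "emeasure lborel (A - T) < ennreal m"
  proof -
    have "A \<in> sets lebesgue" using A(1) by simp
    then obtain T where T: "closed T" "T \<subseteq> A" "emeasure lebesgue (A - T) < ennreal m"
      using m(2) by (rule sets_lebesgue_inner_closed)
    have "A - T \<in> sets lborel" using T(1) A(1) by auto
    then have "emeasure lebesgue (A - T) = emeasure lborel (A - T)" by (simp add: emeasure_completion)
    with T show ?thesis by (intro that) auto
  qed
  have Tb[measurable]: "T \<in> sets borel" using T by auto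
  have T01: "T \<subseteq> {0..1}" using T A by auto
  have fin: "emeasure lborel (T \<inter> B) \<noteq> \<infinity>" for B
  proof (cases "T \<inter> B \<in> sets borel")
    case True
    have "emeasure lborel (T \<inter> B) \<le> emeasure lborel {0..1::real}" using T01 by (intro emeasure_mono) auto
    then show ?thesis by (auto simp: top_unique)
  qed (simp add: emeasure_notin_sets)
  define G where "G x = measure lborel (T \<inter> {..x})" for x
  define c where "c = measure lborel T"
  have emT: "emeasure lborel T = ennreal c"
    using fin[of UNIV] by (simp add: c_def emeasure_eq_ennreal_measure)
  have c: "0 < c"
  proof (rule ccontr)
    assume "\<not> 0 < c"
    then have "emeasure lborel T = 0" by (simp add: emT not_less ennreal_neg)
    then have "emeasure lborel (A - T) = emeasure lborel A" using T A by (subst emeasure_Diff) auto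
    with T m show False by simp
  qed
  have Gdiff: "measure lborel (T \<inter> {a<..b}) = G b - G a" if "a \<le> b" for a b
  proof -
    have "T \<inter> {a<..b} = (T \<inter> {..b}) - (T \<inter> {..a})" using that by auto
    then show ?thesis unfolding G_def using that fin by (subst measure_Diff[symmetric]) auto
  qed
  have G: "0 \<le> G b - G a \<and> G b - G a \<le> b - a" if "a \<le> b" for a b
  proof -
    have "measure lborel (T \<inter> {a<..b}) \<le> measure lborel {a<..b}"
      using that by (intro measure_mono_fmeasurable) (auto simp: fmeasurable_def)
    then show ?thesis using that by (simp add: Gdiff[OF that, symmetric])
  qed
  have Gmono: "G a \<le> G b" if "a \<le> b" for a b using G[OF that] by simp
  have level: "\<exists>x\<in>T. G x = v" if v: "0 < v" "v \<le> c" for v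
  proof -
    have "T \<inter> {..-1} = {}" "T \<inter> {..1} = T" using T01 by auto
    then have "G (-1) = 0" "G 1 = c" by (auto simp: G_def c_def)
    then obtain z where z: "G z = v"
      using IVT'[of G "-1" v 1] continuous_on_bounded_slope[OF G] v by auto
    \<comment> \<open>Moving down from \<open>z\<close> to the nearest point of \<open>T\<close> does not change \<open>G\<close>.\<close>
    define x where "x = Sup (T \<inter> {..z})"
    have "T \<inter> {..z} \<noteq> {}" using z v by (auto simp: G_def)
    moreover have bdd: "bdd_above (T \<inter> {..z})" by (intro bdd_aboveI[of _ z]) auto
    ultimately have "x \<in> T \<inter> {..z}"
      unfolding x_def using T(1) by (intro closed_contains_Sup closed_Int closed_atMost) auto
    moreover have "y \<le> x" if "y \<in> T" "y \<le> z" for y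
      unfolding x_def using that bdd by (intro cSup_upper) auto
    ultimately have "T \<inter> {..x} = T \<inter> {..z}" "x \<in> T" by auto
    then show ?thesis using z by (intro bexI[of _ x]) (auto simp: G_def)
  qed
  obtain p where p: "\<And>v. 0 < v \<Longrightarrow> v \<le> c \<Longrightarrow> p v \<in> T \<and> G (p v) = v" using level by metis
  define q where "q = from_nat_into (\<rat> :: real set)"
  have "infinite (\<rat> :: real set)" using Nats_subset_Rats finite_subset[of \<nat> "\<rat> :: real set"] Nats_infinite by auto
  then have q: "bij_betw q UNIV \<rat>" unfolding q_def by (intro bij_betw_from_nat_into countable_rat)
  have qdense: "\<exists>n. s < q n \<and> q n < t" if st: "s < t" for s t
  proof -
    obtain r where "r \<in> \<rat>" "s < r" "r < t" using Rats_dense_in_real[OF st] by auto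
    then show ?thesis using q by (auto simp: bij_betw_def) (metis imageE)
  qed
  define w where "w n = c * (1/2) ^ Suc n" for n
  have w: "0 < w n" for n using c by (simp add: w_def)
  have sw: "w sums c" unfolding w_def using sums_mult[OF power_half_series, of c] by simp
  define H where "H t = (\<Sum>n. if q n < t then w n else 0)" for t
  have sH: "(\<lambda>n. if q n < t then w n else 0) sums H t" for t
    unfolding H_def
    by (intro summable_sums summable_comparison_test[OF _ sums_summable[OF sw]] exI[of _ 0])
      (auto intro: less_imp_le[OF w])
  have H_le: "H t \<le> c" for t by (rule sums_le[OF _ sH sw]) (auto intro: less_imp_le[OF w])
  have H_mono: "H s \<le> H t" if "s \<le> t" for s t
    by (rule sums_le[OF _ sH sH]) (use that in \<open>auto intro: less_imp_le[OF w]\<close>)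
  have H_jump: "H (q n) + w n < H t" if nt: "q n < t" for n t
  proof -
    \<comment> \<open>The further jump at \<open>q i\<close> makes the inequality strict.\<close>
    obtain i where i: "q n < q i" "q i < t" using qdense[OF nt] by auto
    have s1: "(\<lambda>j. (if q j < q n then w j else 0) + (if j = n then w j else 0) + (if j = i then w j else 0)) sums (H (q n) + w n + w i)"
      by (intro sums_add sH sums_single)
    have "H (q n) + w n + w i \<le> H t"
      by (rule sums_le[OF _ s1 sH]) (use i nt in \<open>auto intro: less_imp_le[OF w]\<close>)
    with w[of i] show ?thesis by linarith
  qed
  have H_nonneg: "0 \<le> H t" for t by (rule sums_le[OF _ sums_zero sH]) (auto intro: less_imp_le[OF w])
  have H_pos: "0 < H t" for t
  proof -
    obtain n where "q n < t" using qdense[of "t - 1" t] by auto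
    then show ?thesis using H_jump[of n t] H_nonneg[of "q n"] w[of n] by linarith
  qed
  have H_strict: "H s < H t" if st: "s < t" for s t
  proof -
    obtain n where "s < q n" "q n < t" using qdense[OF st] by auto
    then show ?thesis using H_jump[of n t] H_mono[of s "q n"] w[of n] by linarith
  qed
  \<comment> \<open>Strictness of \<open>H\<close> carries over to \<open>k\<close> because \<open>G (k t) = H t\<close> and \<open>G\<close> is monotone.\<close>
  define k where "k t = p (H t)" for t
  have k: "k t \<in> T" "G (k t) = H t" for t using p[OF H_pos H_le] by (auto simp: k_def)
  have k_strict: "k s < k t" if "s < t" for s t
    using H_strict[OF that] Gmono[of "k t" "k s"] by (auto simp: k intro: ccontr)
  define b where "b n = p (H (q n) + w n)" for n
  have b: "G (b n) = H (q n) + w n" for n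
  proof -
    have "H (q n) + w n < H (q n + 1)" by (rule H_jump) simp
    with H_le[of "q n + 1"] H_pos[of "q n"] w[of n] p[of "H (q n) + w n"] show ?thesis by (auto simp: b_def)
  qed
  have b_less: "b n < k t" if "q n < t" for n t
    using H_jump[OF that] Gmono[of "k t" "b n"] by (auto simp: k b intro: ccontr)
  have b_gr: "k (q n) < b n" for n
    using w[of n] Gmono[of "b n" "k (q n)"] by (auto simp: k b intro: ccontr)
  \<comment> \<open>The piece of \<open>T\<close> that \<open>k\<close> skips immediately after the rational number \<open>q n\<close>.\<close>
  define J where "J n = T \<inter> {k (q n)<..b n}" for n
  have [measurable]: "J n \<in> sets borel" for n by (simp add: J_def)
  have mJ: "emeasure lborel (J n) = ennreal (w n)" for n
    using Gdiff[of "k (q n)" "b n"] b_gr[of n] fin[of "{k (q n)<..b n}"]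
    by (simp add: J_def emeasure_eq_ennreal_measure b k)
  have dJ: "disjoint_family J"
    unfolding disjoint_family_on_def
  proof (intro ballI impI)
    fix i j :: nat assume "i \<noteq> j"
    then have "q i \<noteq> q j" using q by (auto simp: bij_betw_def inj_on_def)
    then show "J i \<inter> J j = {}"
      using b_less[of i "q j"] b_less[of j "q i"] by (cases "q i < q j") (auto simp: J_def)
  qed
  have "emeasure lborel (\<Union>n. J n) = (\<Sum>n. emeasure lborel (J n))"
    using dJ by (intro suminf_emeasure[symmetric]) auto
  also have "\<dots> = ennreal c" unfolding mJ using w sw by (intro suminf_ennreal_eq) (auto intro: less_imp_le)
  finally have eJ: "emeasure lborel (\<Union>n. J n) = ennreal c" .
  have JT: "(\<Union>n. J n) \<subseteq> T" by (auto simp: J_def)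
  have "emeasure lborel (T - (\<Union>n. J n)) = 0"
    using JT by (subst emeasure_Diff) (simp_all add: eJ emT)
  then have null: "T - (\<Union>n. J n) \<in> null_sets lborel" by (auto simp: null_sets_def)
  have "k t \<notin> J n" for t n
  proof (cases "q n < t")
    case False
    then have "k t \<le> k (q n)" using k_strict[of t "q n"] by (cases "t = q n") auto
    then show ?thesis by (auto simp: J_def)
  qed (use b_less[of n t] in \<open>auto simp: J_def\<close>)
  then have "range k \<subseteq> A \<inter> (T - (\<Union>n. J n))" using k(1) T by auto
  moreover have "strict_mono k" using k_strict by (auto simp: strict_mono_def)
  ultimately show ?thesis using null that by blast
qed

text \<open>The generalised inverse of a strictly increasing function is monotone, hence Borel.\<close>

lemma borel_left_inverse_strict_mono:
  fixes k :: "real \<Rightarrow> real"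
  assumes "strict_mono k"
  obtains l where "l \<in> borel_measurable borel" "\<And>t. t \<in> {0..1} \<Longrightarrow> l (k t) = t"
proof
  define l where "l x = Sup (insert 0 {t \<in> {0..1}. k t \<le> x})" for x
  have "mono l"
    unfolding l_def
    by (intro monoI cSup_subset_mono) (auto intro!: bdd_aboveI[of _ 1])
  then show "l \<in> borel_measurable borel" by (rule borel_measurable_mono)
  fix t :: real assume t: "t \<in> {0..1}"
  then have "insert 0 {s \<in> {0..1}. k s \<le> k t} = {0..t}"
    using assms by (auto simp: strict_mono_less_eq)
  then show "l (k t) = t" using t by (simp add: l_def)
qed

text \<open>A Borel left inverse describes the image as the set of fixed points of \<open>k \<circ> l\<close> lying over \<open>T\<close>. This replaces the
Lusin-Souslin theorem on injective Borel images.\<close>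

lemma borel_image_left_inverse:
  fixes k l :: "real \<Rightarrow> real"
  assumes [measurable]: "k \<in> borel_measurable borel" "l \<in> borel_measurable borel" "T \<in> sets borel"
    and "\<And>x. x \<in> T \<Longrightarrow> l (k x) = x"
  shows "k ` T \<in> sets borel"
proof -
  have "k ` T = {y \<in> space borel. l y \<in> T \<and> k (l y) = y}"
    using assms(4) by auto (metis imageI)
  also have "\<dots> \<in> sets borel" by measurable
  finally show ?thesis .
qed

text \<open>The classical construction: \<open>i\<close> is used on the points whose chain of preimages ends in \<open>P\<close> outside
the image of \<open>j\<close>, and the inverse of \<open>j\<close> on all others. All sets involved are countable unions of images under injections with
Borel left inverses.\<close>

lemma borel_Schroeder_Bernstein:
  fixes i i' j j' :: "real \<Rightarrow> real"
  assumes ms[measurable]: "i \<in> borel_measurable borel" "i' \<in> borel_measurable borel"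
      "j \<in> borel_measurable borel" "j' \<in> borel_measurable borel"
      "P \<in> sets borel" "Q \<in> sets borel"
    and i: "\<And>x. x \<in> P \<Longrightarrow> i x \<in> Q \<and> i' (i x) = x"
    and j: "\<And>y. y \<in> Q \<Longrightarrow> j y \<in> P \<and> j' (j y) = y"
  obtains h h' where "h \<in> borel_measurable borel" "h' \<in> borel_measurable borel"
    "\<And>x. x \<in> P \<Longrightarrow> h x \<in> Q \<and> h' (h x) = x" "\<And>y. y \<in> Q \<Longrightarrow> h' y \<in> P \<and> h (h' y) = y"
proof -
  define X where "X = rec_nat (P - j ` Q) (\<lambda>_ Z. j ` i ` Z)"
  have X0: "X 0 = P - j ` Q" and XS: "X (Suc n) = j ` i ` X n" for n by (simp_all add: X_def)
  have X: "X n \<subseteq> P \<and> X n \<in> sets borel" for n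
  proof (induction n)
    case 0
    have "j ` Q \<in> sets borel" using j by (intro borel_image_left_inverse[of j j']) auto
    then show ?case by (auto simp: X0)
  next
    case (Suc n)
    then have "i ` X n \<in> sets borel" using i by (intro borel_image_left_inverse[of i i']) auto
    then have "j ` i ` X n \<in> sets borel" using i j Suc by (intro borel_image_left_inverse[of j j']) auto
    then show ?case using Suc i j by (auto simp: XS)
  qed
  define Z where "Z = (\<Union>n. X n)"
  have ZP: "Z \<subseteq> P" and [measurable]: "Z \<in> sets borel" using X by (auto simp: Z_def)
  have [measurable]: "i ` Z \<in> sets borel" using i ZP by (intro borel_image_left_inverse[of i i']) auto
  define h where "h x = (if x \<in> Z then i x else j' x)" for x
  define h' where "h' y = (if y \<in> i ` Z then i' y else j y)" for y
  have outside: "j' x \<in> Q \<and> j (j' x) = x \<and> j' x \<notin> i ` Z" if x: "x \<in> P" "x \<notin> Z" for x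
  proof -
    have "x \<notin> X 0" using x by (auto simp: Z_def)
    then obtain y where y: "y \<in> Q" "x = j y" using x by (auto simp: X0)
    have "y \<notin> i ` Z"
    proof
      assume "y \<in> i ` Z"
      then obtain n z where "z \<in> X n" "y = i z" by (auto simp: Z_def)
      then have "x \<in> X (Suc n)" using y by (auto simp: XS)
      with x show False by (auto simp: Z_def)
    qed
    with y j show ?thesis by auto
  qed
  have outside': "j y \<notin> Z" if y: "y \<in> Q" "y \<notin> i ` Z" for y
  proof
    assume "j y \<in> Z"
    then obtain n where n: "j y \<in> X n" by (auto simp: Z_def)
    show False
    proof (cases n)
      case 0
      then show False using n y by (auto simp: X0)
    next
      case (Suc m)
      then obtain z where z: "z \<in> X m" "j y = j (i z)" using n by (auto simp: XS)
      then have "i z \<in> Q" using X i by blast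
      then have "y = i z" using z j y by metis
      with z y show False by (auto simp: Z_def)
    qed
  qed
  show ?thesis
  proof (rule that[of h h'])
    show "h \<in> borel_measurable borel" unfolding h_def by measurable
    show "h' \<in> borel_measurable borel" unfolding h'_def by measurable
    show "h x \<in> Q \<and> h' (h x) = x" if "x \<in> P" for x
      using that i[OF that] outside[OF that] by (cases "x \<in> Z") (auto simp: h_def h'_def)
    show "h' y \<in> P \<and> h (h' y) = y" if "y \<in> Q" for y
    proof (cases "y \<in> i ` Z")
      case True
      then obtain z where "z \<in> Z" "y = i z" by auto
      with i[of z] ZP show ?thesis by (auto simp: h_def h'_def)
    next
      case False
      with that j[OF that] outside'[OF that] show ?thesis by (auto simp: h_def h'_def)
    qed
  qed
qed

text \<open>The map \<open>f\<close> is kept on the points \<open>A'\<close> where \<open>g\<close> inverts it and which avoid a null set \<open>N\<close>; there it is a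
bijection onto \<open>B'\<close>. The set \<open>N\<close> is chosen such that the exceptional sets \<open>P\<close> and \<open>Q\<close> are null and yet contain Borel
copies of \<open>[0, 1]\<close>, namely the range of \<open>k\<close> and its image under \<open>f\<close>. So each of them embeds into the
other.\<close>

lemma ae_inverse_to_borel_bijection:
  fixes f g :: "real \<Rightarrow> real"
  assumes ms[measurable]: "f \<in> borel_measurable borel" "g \<in> borel_measurable borel"
    and f01: "\<And>x. x \<in> {0..1} \<Longrightarrow> f x \<in> {0..1}" and g01: "\<And>y. y \<in> {0..1} \<Longrightarrow> g y \<in> {0..1}"
    and gf: "AE x in lborel. x \<in> {0..1} \<longrightarrow> g (f x) = x"
    and fg: "AE y in lborel. y \<in> {0..1} \<longrightarrow> f (g y) = y"
    and null: "\<And>N. N \<in> null_sets lborel \<Longrightarrow> {y \<in> {0..1}. g y \<in> N} \<in> null_sets lborel"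
  obtains F G where "F \<in> borel_measurable borel" "G \<in> borel_measurable borel"
    "\<And>x. x \<in> {0..1} \<Longrightarrow> F x \<in> {0..1} \<and> G (F x) = x"
    "\<And>y. y \<in> {0..1} \<Longrightarrow> G y \<in> {0..1} \<and> F (G y) = y"
    "AE x in lborel. x \<in> {0..1} \<longrightarrow> F x = f x"
    "AE y in lborel. y \<in> {0..1} \<longrightarrow> G y = g y"
proof -
  define A where "A = {x \<in> {0..1}. g (f x) = x}"
  define B where "B = {y \<in> {0..1}. f (g y) = y}"
  have [measurable]: "A \<in> sets borel" "B \<in> sets borel"
    unfolding A_def B_def by measurable
  have nA: "{0..1} - A \<in> null_sets lborel"
    using gf by (subst AE_iff_null_sets) (auto elim!: eventually_mono simp: A_def)
  have nB: "{0..1} - B \<in> null_sets lborel"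
    using fg by (subst AE_iff_null_sets) (auto elim!: eventually_mono simp: B_def)
  have Anull: "A \<notin> null_sets lborel"
  proof
    assume "A \<in> null_sets lborel"
    then have "A \<union> ({0..1} - A) \<in> null_sets lborel" using nA by (rule null_sets.Un)
    moreover have "A \<union> ({0..1} - A) = {0..1}" by (auto simp: A_def)
    ultimately show False by (auto simp: null_sets_def)
  qed
  have A01: "A \<subseteq> {0..1}" by (auto simp: A_def)
  obtain k :: "real \<Rightarrow> real" and N where k: "strict_mono k" "range k \<subseteq> A \<inter> N" and N: "N \<in> null_sets lborel"
    by (rule strict_mono_into_null_subset[OF \<open>A \<in> sets borel\<close> A01 Anull])
  have [measurable]: "k \<in> borel_measurable borel"
    using k(1) by (intro borel_measurable_mono strict_mono_mono)
  have [measurable]: "N \<in> sets borel" using N by auto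
  obtain l where l[measurable]: "l \<in> borel_measurable borel" and lk: "\<And>t. t \<in> {0..1} \<Longrightarrow> l (k t) = t"
    using borel_left_inverse_strict_mono[OF k(1)] by auto
  define A' where "A' = A - N"
  define B' where "B' = {y \<in> B. g y \<notin> N}"
  define P where "P = {0..1} - A'"
  define Q where "Q = {0..1} - B'"
  have [measurable]: "A' \<in> sets borel" "B' \<in> sets borel" "P \<in> sets borel" "Q \<in> sets borel"
    unfolding A'_def B'_def P_def Q_def by measurable
  have kAN: "k t \<in> A" "k t \<in> N" for t using k(2) by auto
  have nP: "P \<in> null_sets lborel"
    by (rule null_sets_subset[OF null_sets.Un[OF nA N]]) (auto simp: P_def A'_def)
  have nQ: "Q \<in> null_sets lborel"
    by (rule null_sets_subset[OF null_sets.Un[OF nB null[OF N]]]) (auto simp: Q_def B'_def B_def)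
  have fA': "f x \<in> B' \<and> g (f x) = x" if "x \<in> A'" for x
    using that f01 by (auto simp: A'_def A_def B'_def B_def)
  have gB': "g y \<in> A' \<and> f (g y) = y" if "y \<in> B'" for y
    using that g01 by (auto simp: A'_def A_def B'_def B_def)
  obtain h h' where [measurable]: "h \<in> borel_measurable borel" "h' \<in> borel_measurable borel"
    and h: "\<And>x. x \<in> P \<Longrightarrow> h x \<in> Q \<and> h' (h x) = x" and h': "\<And>y. y \<in> Q \<Longrightarrow> h' y \<in> P \<and> h (h' y) = y"
  proof (rule borel_Schroeder_Bernstein[of "\<lambda>x. f (k x)" "\<lambda>y. l (g y)" k l P Q])
    fix x assume "x \<in> P"
    then show "f (k x) \<in> Q \<and> l (g (f (k x))) = x"
      using kAN[of x] lk[of x] f01[of "k x"] by (auto simp: P_def Q_def B'_def A_def)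
  next
    fix y assume "y \<in> Q"
    then show "k y \<in> P \<and> l (k y) = y" using kAN[of y] lk[of y] by (auto simp: P_def Q_def A'_def A_def)
  qed auto
  define F where "F x = (if x \<in> A' then f x else h x)" for x
  define G where "G y = (if y \<in> B' then g y else h' y)" for y
  show ?thesis
  proof (rule that[of F G])
    show "F \<in> borel_measurable borel" "G \<in> borel_measurable borel"
      unfolding F_def G_def by measurable
    have sub: "A' \<subseteq> {0..1}" "B' \<subseteq> {0..1}" by (auto simp: A'_def A_def B'_def B_def)
    show "F x \<in> {0..1} \<and> G (F x) = x" if "x \<in> {0..1}" for x
      using that fA'[of x] h[of x] sub by (cases "x \<in> A'") (auto simp: F_def G_def P_def Q_def)
    show "G y \<in> {0..1} \<and> F (G y) = y" if "y \<in> {0..1}" for y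
      using that gB'[of y] h'[of y] sub by (cases "y \<in> B'") (auto simp: F_def G_def P_def Q_def)
    show "AE x in lborel. x \<in> {0..1} \<longrightarrow> F x = f x"
      using AE_not_in[OF nP] by eventually_elim (auto simp: F_def P_def)
    show "AE y in lborel. y \<in> {0..1} \<longrightarrow> G y = g y"
      using AE_not_in[OF nQ] by eventually_elim (auto simp: G_def Q_def)
  qed
qed

section \<open>Lebesgue measure on the unit interval and the unit square\<close>

text \<open>Lebesgue measure on the unit interval, but with all Borel sets of the line as measurable sets, so that functions
on the whole line need no restriction.\<close>

definition unit_measure :: "real measure" where
  "unit_measure = density lborel (\<lambda>x. ennreal (indicator {0..1} x))"

abbreviation "U \<equiv> unit_measure"

lemma sets_U[simp, measurable_cong]: "sets U = sets borel"
  by (simp add: unit_measure_def)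

lemma space_U[simp]: "space U = UNIV"
  by (simp add: unit_measure_def)

lemma emeasure_U:
  assumes "A \<in> sets borel"
  shows "emeasure U A = emeasure lborel ({0..1} \<inter> A)"
proof -
  have "emeasure U A = (\<integral>\<^sup>+x. ennreal (indicator {0..1} x) * indicator A x \<partial>lborel)"
    unfolding unit_measure_def using assms by (intro emeasure_density) auto
  also have "\<dots> = (\<integral>\<^sup>+x. indicator ({0..1} \<inter> A) x \<partial>lborel)"
    by (intro nn_integral_cong) (auto simp: indicator_def)
  also have "\<dots> = emeasure lborel ({0..1} \<inter> A)"
    using assms by (intro nn_integral_indicator) auto
  finally show ?thesis .
qed

lemma prob_space_U: "prob_space U"
  by (rule prob_spaceI) (simp add: emeasure_U)

interpretation U: prob_space U by (rule prob_space_U)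
interpretation UU: pair_prob_space U U ..

lemma AE_U: "(AE x in U. P x) \<longleftrightarrow> (AE x in lborel. x \<in> {0..1} \<longrightarrow> P x)"
  unfolding unit_measure_def by (subst AE_density) (auto simp: indicator_def)

lemma integral_U: "f \<in> borel_measurable borel \<Longrightarrow> (\<integral>x. f x \<partial>U) = (LBINT x:{0..1}. f x)"
  for f :: "real \<Rightarrow> real"
  unfolding unit_measure_def set_lebesgue_integral_def by (subst integral_density) auto

lemma AE_UU: "(AE z in U \<Otimes>\<^sub>M U. P z) \<longleftrightarrow> (AE z in lebesgue_on ({0..1} \<times> {0..1}). P z)"
proof -
  have "U \<Otimes>\<^sub>M U = density (lborel \<Otimes>\<^sub>M lborel)
      (\<lambda>(x, y). ennreal (indicator {0..1} x) * ennreal (indicator {0..1} y))"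
    using U.sigma_finite_measure_axioms unfolding unit_measure_def
    by (intro pair_measure_density) (auto intro: lborel.sigma_finite_measure_axioms)
  also have "\<dots> = density lborel (indicator ({0..1} \<times> {0..1}))"
    unfolding lborel_prod by (intro arg_cong[where f="density lborel"]) (auto simp: fun_eq_iff indicator_def)
  finally have eq: "U \<Otimes>\<^sub>M U = density lborel (indicator ({0..1} \<times> {0..1}))" .
  have c: "{0..1::real} \<times> {0..1::real} \<in> sets borel" by (intro borel_closed closed_Times closed_atLeastAtMost)
  have "(AE z in U \<Otimes>\<^sub>M U. P z) \<longleftrightarrow> (AE z in lborel. z \<in> {0..1} \<times> {0..1} \<longrightarrow> P z)"
    unfolding eq using c by (subst AE_density) (auto simp: indicator_def)
  also have "\<dots> \<longleftrightarrow> (AE z in lebesgue. z \<in> {0..1} \<times> {0..1} \<longrightarrow> P z)"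
    by (rule AE_completion_iff[symmetric])
  also have "\<dots> \<longleftrightarrow> (AE z in lebesgue_on ({0..1} \<times> {0..1}). P z)"
    using c by (intro AE_restrict_space_iff[symmetric]) auto
  finally show ?thesis .
qed

section \<open>The partial derivatives of a copula\<close>

definition clip :: "real \<Rightarrow> real" where "clip t = max 0 (min 1 t)"

text \<open>Continuation of \<open>C\<close> from the unit square to the plane, constant beyond the edges. It retains the slope bounds and
has two-sided difference quotients at every point.\<close>

definition extend :: "(real \<Rightarrow> real \<Rightarrow> real) \<Rightarrow> real \<Rightarrow> real \<Rightarrow> real" where
  "extend C x y = C (clip x) (clip y)"

lemma clip_in: "clip t \<in> {0..1}" and clip_id: "t \<in> {0..1} \<Longrightarrow> clip t = t"
  and clip_slope: "a \<le> b \<Longrightarrow> 0 \<le> clip b - clip a \<and> clip b - clip a \<le> b - a"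
  by (auto simp: clip_def)

lemma copula_increasing:
  assumes "copula C" "u \<in> {0..1}" "v \<in> {0..1}" "x \<in> {0..1}" "y \<in> {0..1}" "x \<le> u" "y \<le> v"
  shows "C u y + C x v \<le> C u v + C x y"
proof -
  have "C u v - C u y - C x v + C x y \<ge> 0"
    using assms unfolding copula_def by blast
  then show ?thesis by simp
qed

lemma copula_swap:
  assumes C: "copula C"
  shows "copula (\<lambda>x y. C y x)"
  unfolding copula_def
proof (intro conjI ballI impI)
  fix u v x y :: real
  assume "u \<in> {0..1}" "v \<in> {0..1}" "x \<in> {0..1}" "y \<in> {0..1}" "x \<le> u" "y \<le> v"
  then show "0 \<le> C v u - C y u - C v x + C y x"
    using copula_increasing[OF C, of v u y x] by simp
qed (use C in \<open>simp_all add: copula_def\<close>)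

lemma extend_swap: "extend (\<lambda>x y. C y x) x y = extend C y x"
  by (simp add: extend_def)

text \<open>The rectangle inequality read as: the increments of \<open>C\<close> in the first variable grow with the second.\<close>

lemma copula_rectangle:
  assumes "copula C" "a \<le> b" "c \<le> d"
  shows "extend C a d - extend C a c \<le> extend C b d - extend C b c"
proof -
  have "clip a \<le> clip b" "clip c \<le> clip d" using assms clip_slope by auto
  then show ?thesis
    using copula_increasing[OF assms(1), of "clip b" "clip d" "clip a" "clip c"] clip_in
    by (simp add: extend_def)
qed

lemma extend_0: "copula C \<Longrightarrow> x \<le> 0 \<Longrightarrow> extend C x y = 0" "copula C \<Longrightarrow> y \<le> 0 \<Longrightarrow> extend C x y = 0"
  using clip_in unfolding copula_def extend_def by (auto simp: clip_def)

lemma extend_1: "copula C \<Longrightarrow> 1 \<le> x \<Longrightarrow> extend C x y = clip y" "copula C \<Longrightarrow> 1 \<le> y \<Longrightarrow> extend C x y = clip x"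
  using clip_in unfolding copula_def extend_def by (auto simp: clip_def)

text \<open>The lower bound is the rectangle inequality over \<open>[0, y]\<close>, the upper bound the one over \<open>[y, 1]\<close>.\<close>

lemma extend_slope1:
  assumes "copula C" "a \<le> b"
  shows "0 \<le> extend C b y - extend C a y \<and> extend C b y - extend C a y \<le> b - a"
proof -
  have "extend C a y = extend C a (clip y)" "extend C b y = extend C b (clip y)"
    by (auto simp: extend_def clip_id[OF clip_in])
  then show ?thesis
  using copula_rectangle[OF assms, of 0 "clip y"] copula_rectangle[OF assms, of "clip y" 1]
    extend_0(2)[OF assms(1), of 0] extend_1(2)[OF assms(1), of 1] clip_slope[OF assms(2)] clip_in[of y] by auto
qed

lemma extend_slope2:
  assumes "copula C" "a \<le> b"
  shows "0 \<le> extend C x b - extend C x a \<and> extend C x b - extend C x a \<le> b - a"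
  using extend_slope1[OF copula_swap[OF assms(1)] assms(2), of x] by (simp add: extend_swap[of C])

lemma extend_continuous:
  assumes C: "copula C"
  shows "continuous_on UNIV (\<lambda>z. extend C (fst z) (snd z))"
proof (rule lipschitz_on_continuous_on, rule lipschitz_onI)
  fix z w :: "real \<times> real"
  have 1: "\<bar>extend C a y - extend C b y\<bar> \<le> \<bar>a - b\<bar>" for a b y
    using extend_slope1[OF C, of a b y] extend_slope1[OF C, of b a y] by (cases "a \<le> b") auto
  have 2: "\<bar>extend C x a - extend C x b\<bar> \<le> \<bar>a - b\<bar>" for a b x
    using extend_slope2[OF C, of a b x] extend_slope2[OF C, of b a x] by (cases "a \<le> b") auto
  show "dist (extend C (fst z) (snd z)) (extend C (fst w) (snd w)) \<le> 2 * dist z w"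
    using 1[of "fst z" "snd z" "fst w"] 2[of "fst w" "snd z" "snd w"] dist_fst_le[of z w] dist_snd_le[of z w]
    unfolding dist_real_def by linarith
qed auto

definition differentiable1 :: "(real \<Rightarrow> real \<Rightarrow> real) \<Rightarrow> (real \<times> real) set" where
  "differentiable1 C = {(x, y). \<forall>p\<in>\<rat>. \<forall>q\<in>\<rat>. p < q \<longrightarrow> x \<notin> slope_gap (\<lambda>u. extend C u y) p q}"

text \<open>The derivative of the continuation in the first variable. The limit along one sequence of step sizes makes it Borel in both
variables jointly; the truncation to \<open>[0, 1]\<close> gives it bounded values also where the limit does
not exist.\<close>

definition D1 :: "(real \<Rightarrow> real \<Rightarrow> real) \<Rightarrow> real \<Rightarrow> real \<Rightarrow> real" where
  "D1 C x y = max 0 (min 1 (lim (\<lambda>n. (extend C (x + 1 / Suc n) y - extend C x y) * Suc n)))"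

lemma D1_range: "0 \<le> D1 C x y" "D1 C x y \<le> 1" by (auto simp: D1_def)

lemma extend_measurable:
  assumes C: "copula C" and [measurable]: "a \<in> borel_measurable M" "b \<in> borel_measurable M"
  shows "(\<lambda>z. extend C (a z) (b z)) \<in> borel_measurable M"
proof -
  have "(\<lambda>z. extend C (fst z) (snd z)) \<in> borel_measurable (borel \<Otimes>\<^sub>M borel)"
    unfolding borel_prod by (rule borel_measurable_continuous_onI[OF extend_continuous[OF C]])
  from measurable_compose[OF _ this, of "\<lambda>z. (a z, b z)" M] show ?thesis by simp
qed

lemma D1_measurable:
  assumes C: "copula C" and [measurable]: "a \<in> borel_measurable M" "b \<in> borel_measurable M"
  shows "(\<lambda>z. D1 C (a z) (b z)) \<in> borel_measurable M"
  unfolding D1_def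
  by (intro borel_measurable_max borel_measurable_min borel_measurable_const borel_measurable_lim_metric
      borel_measurable_times borel_measurable_diff extend_measurable[OF C] borel_measurable_add assms)

text \<open>Countably many slope gaps suffice, each of them jointly Borel.\<close>

lemma differentiable1_borel:
  assumes C: "copula C"
  shows "differentiable1 C \<in> sets (borel \<Otimes>\<^sub>M borel)"
proof -
  have "continuous_on UNIV (extend C x)" for x
    by (rule continuous_on_bounded_slope[OF extend_slope2[OF C]])
  then have [measurable]: "{(x, y). x \<in> slope_gap (\<lambda>u. extend C u y) p q} \<in> sets (borel \<Otimes>\<^sub>M borel)" for p q
    unfolding borel_prod by (rule slope_gap_borel_prod)
  have "differentiable1 C = (\<Inter>p\<in>\<rat>. \<Inter>q\<in>\<rat> \<inter> {p<..}. - {(x, y). x \<in> slope_gap (\<lambda>u. extend C u y) p q})"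
    unfolding differentiable1_def by auto
  also have "\<dots> \<in> sets (borel \<Otimes>\<^sub>M borel)"
  proof (rule sets.countable_INT''[OF _ countable_rat], goal_cases)
    case 1 then show ?case by (metis sets.top space_borel space_pair_measure UNIV_Times_UNIV)
  next
    case (2 p)
    have "countable (\<rat> \<inter> {p<..})" by (simp add: countable_Int1 countable_rat)
    show ?case
    proof (rule sets.countable_INT''[OF _ \<open>countable (\<rat> \<inter> {p<..})\<close>], goal_cases)
      case 1 then show ?case by (metis sets.top space_borel space_pair_measure UNIV_Times_UNIV)
    next
      case (2 q)
      then show ?case
        using sets.compl_sets[of "{(x, y). x \<in> slope_gap (\<lambda>u. extend C u y) p q}" "borel \<Otimes>\<^sub>M borel"]
        by (simp add: space_pair_measure Compl_eq_Diff_UNIV)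
    qed
  qed
  finally show ?thesis .
qed

lemma AE_differentiable1:
  assumes C: "copula C"
  shows "AE x in lborel. (x, y) \<in> differentiable1 C"
proof -
  have "AE x in lborel. \<forall>p\<in>\<rat>. \<forall>q\<in>\<rat>. p < q \<longrightarrow> x \<notin> slope_gap (\<lambda>u. extend C u y) p q"
    using AE_not_in[OF slope_gap_null[OF extend_slope1[OF C]]]
    by (intro AE_ball_countable'[OF _ countable_rat]) auto
  then show ?thesis by (simp add: differentiable1_def)
qed

lemma has_derivative_D1:
  assumes C: "copula C" and d: "(x, y) \<in> differentiable1 C"
  shows "((\<lambda>u. extend C u y) has_real_derivative D1 C x y) (at x)"
proof -
  obtain D where D: "((\<lambda>u. extend C u y) has_real_derivative D) (at x)"
    using differentiable_outside_slope_gaps[OF extend_slope1[OF C], of x y] d unfolding differentiable1_def by auto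
  from tendsto_difference_quotient_seq[OF D]
  have lim: "(\<lambda>n. (extend C (x + 1 / Suc n) y - extend C x y) * Suc n) \<longlonglongrightarrow> D" .
  have b: "0 \<le> (extend C (x + 1 / Suc n) y - extend C x y) * Suc n"
       "(extend C (x + 1 / Suc n) y - extend C x y) * Suc n \<le> 1 / Suc n * Suc n" for n
    using extend_slope1[OF C, of x "x + 1 / Suc n" y] by (intro mult_nonneg_nonneg mult_right_mono; simp)+
  have "0 \<le> D" by (rule LIMSEQ_le_const[OF lim]) (use b(1) in auto)
  moreover have "D \<le> 1" by (rule LIMSEQ_le_const2[OF lim]) (use b(2) in auto)
  ultimately have "D1 C x y = D" unfolding D1_def limI[OF lim] by simp
  with D show ?thesis by simp
qed

text \<open>Difference quotients of \<open>C(\<cdot>, y)\<close> grow with \<open>y\<close> by the rectangle inequality.\<close>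

lemma D1_mono:
  assumes C: "copula C" and d: "(x, y) \<in> differentiable1 C" "(x, y') \<in> differentiable1 C" and "y \<le> y'"
  shows "D1 C x y \<le> D1 C x y'"
proof (rule LIMSEQ_le[OF tendsto_difference_quotient_seq[OF has_derivative_D1[OF C d(1)]]
      tendsto_difference_quotient_seq[OF has_derivative_D1[OF C d(2)]]], intro exI allI impI)
  fix n
  show "(extend C (x + 1 / Suc n) y - extend C x y) * Suc n \<le> (extend C (x + 1 / Suc n) y' - extend C x y') * Suc n"
    using copula_rectangle[OF C, of x "x + 1 / Suc n" y y'] \<open>y \<le> y'\<close> by (intro mult_right_mono) auto
qed

lemma integral_D1:
  assumes C: "copula C" and "a \<le> b"
  shows "(LBINT x:{a..b}. D1 C x y) = extend C b y - extend C a y"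
proof (rule integral_derivative_bounded_slope[OF extend_slope1[OF C] _ _ assms(2)])
  show "(\<lambda>x. D1 C x y) \<in> borel_measurable borel" by (intro D1_measurable[OF C]) auto
  show "AE x in lborel. ((\<lambda>u. extend C u y) has_real_derivative D1 C x y) (at x)"
    using AE_differentiable1[OF C, of y] by eventually_elim (rule has_derivative_D1[OF C])
qed

lemma has_derivative_D1_within:
  assumes C: "copula C" and d: "(x, y) \<in> differentiable1 C" and xy: "x \<in> {0..1}" "y \<in> {0..1}"
  shows "((\<lambda>u. C u y) has_real_derivative D1 C x y) (at x within {0..1})"
proof (rule has_field_derivative_transform_within[OF _ zero_less_one])
  show "((\<lambda>u. extend C u y) has_real_derivative D1 C x y) (at x within {0..1})"
    by (rule has_field_derivative_at_within[OF has_derivative_D1[OF C d]])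
qed (use xy in \<open>auto simp: extend_def clip_id\<close>)

lemma partial1_eq_D1:
  assumes C: "copula C" and d: "(x, y) \<in> differentiable1 C" and xy: "x \<in> {0..1}" "y \<in> {0..1}"
  shows "partial1 C x y = D1 C x y"
proof -
  have "((\<lambda>u. C u y) has_vector_derivative D1 C x y) (at x within {0..1})"
    using has_derivative_D1_within[OF assms] by (simp add: has_real_derivative_iff_has_vector_derivative)
  then show ?thesis unfolding partial1_def
    using vector_derivative_within_cbox[of 0 1 x "\<lambda>u. C u y" "D1 C x y"] xy by simp
qed

lemma partial2_eq_partial1_swap: "partial2 C x y = partial1 (\<lambda>x y. C y x) y x"
  by (simp add: partial1_def partial2_def)

section \<open>Unit Sobolev norm forces derivatives in {0, 1}\<close>

text \<open>Holds also for an \<open>f\<close> that is not measurable, as its integral is then \<open>0\<close> by convention. This permits passing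
from \<open>partial1\<close> and \<open>partial2\<close>, whose values on a null set are arbitrary, to the Borel versions.\<close>

lemma integral_le_if_AE_eq:
  fixes f g :: "'a \<Rightarrow> real"
  assumes "AE x in M. f x = g x" "g \<in> borel_measurable M" "\<And>x. 0 \<le> g x"
  shows "integral\<^sup>L M f \<le> integral\<^sup>L M g"
proof (cases "f \<in> borel_measurable M")
  case True
  with assms integral_cong_AE[of f M g] show ?thesis by auto
next
  case False
  then have "\<not> integrable M f" by (auto dest: borel_measurable_integrable)
  with assms(3) show ?thesis by (simp add: not_integrable_integral_eq)
qed

lemma AE_AE_differentiable1:
  assumes C: "copula C"
  shows "AE x in lborel. AE y in lborel. (x, y) \<in> differentiable1 C"
proof (subst lborel_pair.AE_commute[of "\<lambda>x y. (x, y) \<in> differentiable1 C"])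
  show "AE y in lborel. AE x in lborel. (x, y) \<in> differentiable1 C" using AE_differentiable1[OF C] by simp
qed (use differentiable1_borel[OF C] in \<open>auto simp: space_pair_measure\<close>)

lemma integrable_U_bounded:
  fixes f :: "real \<Rightarrow> real"
  assumes "f \<in> borel_measurable borel" "\<And>x. \<bar>f x\<bar> \<le> B"
  shows "integrable U f"
  by (rule U.integrable_const_bound[of _ B]) (use assms in auto)

lemma integrable_UU_bounded:
  fixes f :: "real \<times> real \<Rightarrow> real"
  assumes "f \<in> borel_measurable (borel \<Otimes>\<^sub>M borel)" "\<And>x. \<bar>f x\<bar> \<le> B"
  shows "integrable (U \<Otimes>\<^sub>M U) f"
  by (rule UU.P.integrable_const_bound[of _ B]) (use assms in auto)

lemma integral_U_clip: "(\<integral>x. clip x \<partial>U) = 1 / 2"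
proof -
  have "(\<integral>x. clip x \<partial>U) = (LBINT x:{0..1}. clip x)" 
    by (rule integral_U) (simp add: clip_def)
  also have "\<dots> = (\<integral>x. x * indicator {0..1} x \<partial>lborel)"
    unfolding set_lebesgue_integral_def by (intro Bochner_Integration.integral_cong) (auto simp: indicator_def clip_def)
  also have "\<dots> = 1\<^sup>2 / 2 - 0\<^sup>2 / (2::real)"
    by (rule integral_FTC_Icc_real) (auto intro!: derivative_eq_intros)
  finally show ?thesis by simp
qed

text \<open>Write \<open>a\<close> and \<open>b\<close> for the two derivatives. The norm bounds the integral of \<open>a\<^sup>2 + b\<^sup>2\<close> below by \<open>1\<close>, while the
integral of \<open>a + b\<close> equals \<open>1\<close> by Fubini. Hence the nonnegative function \<open>a + b - a\<^sup>2 - b\<^sup>2\<close> vanishes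
almost everywhere.\<close>

lemma unit_norm_imp_zero_one_derivatives:
  assumes C: "copula C" and norm: "sobolev_norm C = 1"
  shows "AE z in U \<Otimes>\<^sub>M U. D1 C (fst z) (snd z) \<in> {0, 1} \<and> D1 (\<lambda>x y. C y x) (snd z) (fst z) \<in> {0, 1}"
proof -
  define C' where "C' = (\<lambda>x y. C y x)"
  have C': "copula C'" using copula_swap[OF C] by (simp add: C'_def)
  note [measurable] = D1_measurable[OF C] D1_measurable[OF C']
  define h where "h x y = (D1 C x y)\<^sup>2 + (D1 C' y x)\<^sup>2" for x y
  have hm[measurable]: "(\<lambda>z. h (a z) (b z)) \<in> borel_measurable M"
    if [measurable]: "a \<in> borel_measurable M" "b \<in> borel_measurable M" for a b and M :: "'a measure"
    unfolding h_def by measurable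
  have sq: "(D1 E x y)\<^sup>2 \<le> D1 E x y" for E x y
    using D1_range[of E x y] by (simp add: power2_eq_square mult_left_le)
  have h: "0 \<le> h x y" "h x y \<le> 2" for x y
    using sq[of C x y] sq[of C' y x] D1_range[of C x y] D1_range[of C' y x] by (auto simp: h_def)
  define inner where "inner y = (LBINT x:{0..1}. (partial1 C x y)\<^sup>2 + (partial2 C x y)\<^sup>2)" for y
  define J where "J y = (\<integral>x. h x y \<partial>U)" for y
  have J_eq: "J y = (LBINT x:{0..1}. h x y)" for y unfolding J_def by (intro integral_U) auto
  have [measurable]: "J \<in> borel_measurable borel" unfolding J_def by measurable
  have inner_le: "AE y in lborel. y \<in> {0..1} \<longrightarrow> inner y \<le> J y"
    using AE_AE_differentiable1[OF C']
  proof eventually_elim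
    case (elim y)
    show ?case
    proof
      assume y: "y \<in> {0..1}"
      have "AE x in lborel. indicator {0..1} x *\<^sub>R ((partial1 C x y)\<^sup>2 + (partial2 C x y)\<^sup>2)
            = indicator {0..1} x *\<^sub>R h x y"
        using elim AE_differentiable1[OF C, of y]
      proof eventually_elim
        case (elim x)
        then show ?case
          using y partial1_eq_D1[OF C, of x y] partial1_eq_D1[OF C', of y x]
          by (auto simp: h_def partial2_eq_partial1_swap C'_def indicator_def)
      qed
      then show "inner y \<le> J y"
        unfolding J_eq inner_def set_lebesgue_integral_def
        by (rule integral_le_if_AE_eq) (use h in \<open>auto simp: indicator_def\<close>)
    qed
  qed
  \<comment> \<open>A nonzero integral shows that the outer integrand is integrable.\<close>
  have one: "(LBINT y:{0..1}. inner y) = 1"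
    using norm unfolding sobolev_norm_def inner_def[symmetric] by simp
  then have int: "integrable lborel (\<lambda>y. indicator {0..1} y *\<^sub>R inner y)"
    unfolding set_lebesgue_integral_def using not_integrable_integral_eq by fastforce
  have Jb: "0 \<le> J y" "J y \<le> 2" for y
  proof -
    show "0 \<le> J y" unfolding J_def using h by (intro Bochner_Integration.integral_nonneg) auto
    have "J y \<le> (\<integral>x. 2 \<partial>U)" unfolding J_def using h
      by (intro Bochner_Integration.integral_mono integrable_U_bounded[of _ 2]) auto
    then show "J y \<le> 2" using U.prob_space by simp
  qed
  have "(LBINT y:{0..1}. inner y) \<le> (LBINT y:{0..1}. J y)"
    unfolding set_lebesgue_integral_def
  proof (rule integral_mono_AE[OF int])
    have "integrable lborel (\<lambda>y. indicator {0..1} y *\<^sub>R J y)"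
      by (rule integrableI_bounded_set_indicator[of "{0..1}" _ _ 2]) (use Jb in auto)
    then show "integrable lborel (\<lambda>y. indicator {0..1} y *\<^sub>R J y)" .
    show "AE y in lborel. indicator {0..1} y *\<^sub>R inner y \<le> indicator {0..1} y *\<^sub>R J y"
      using inner_le by eventually_elim (auto simp: indicator_def)
  qed
  also have "\<dots> = (\<integral>y. J y \<partial>U)" by (intro integral_U[symmetric]) auto
  also have "\<dots> = (\<integral>z. h (fst z) (snd z) \<partial>(U \<Otimes>\<^sub>M U))"
    unfolding J_def using UU.integral_snd[of "\<lambda>x y. h x y"] h
    by (simp add: case_prod_unfold integrable_UU_bounded[of _ 2])
  finally have ge: "1 \<le> (\<integral>z. h (fst z) (snd z) \<partial>(U \<Otimes>\<^sub>M U))"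
    unfolding one .
  have i1: "integrable (U \<Otimes>\<^sub>M U) (\<lambda>z. D1 C (fst z) (snd z))"
    by (rule integrable_UU_bounded[of _ 1]) (use D1_range[of C] in auto)
  have i2: "integrable (U \<Otimes>\<^sub>M U) (\<lambda>z. D1 C' (snd z) (fst z))"
    by (rule integrable_UU_bounded[of _ 1]) (use D1_range[of C'] in auto)
  have m: "(\<integral>x. D1 E x y \<partial>U) = clip y" if E: "copula E" for E y
  proof -
    have "(\<lambda>x. D1 E x y) \<in> borel_measurable borel" by (intro D1_measurable[OF E]) auto
    then show ?thesis
    using integral_D1[OF E, of 0 1 y] extend_0(1)[OF E, of 0 y] extend_1(1)[OF E, of 1 y]
    by (subst integral_U) auto
  qed
  have "(\<integral>z. D1 C (fst z) (snd z) \<partial>(U \<Otimes>\<^sub>M U)) = (\<integral>y. (\<integral>x. D1 C x y \<partial>U) \<partial>U)"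
    using UU.integral_snd[of "\<lambda>x y. D1 C x y"] i1 by (simp add: case_prod_unfold)
  then have e1: "(\<integral>z. D1 C (fst z) (snd z) \<partial>(U \<Otimes>\<^sub>M U)) = 1 / 2"
    by (simp add: m[OF C] integral_U_clip)
  have "(\<integral>z. D1 C' (snd z) (fst z) \<partial>(U \<Otimes>\<^sub>M U)) = (\<integral>x. (\<integral>y. D1 C' y x \<partial>U) \<partial>U)"
    using UU.integral_fst'[of "\<lambda>z. D1 C' (snd z) (fst z)"] i2 by (simp add: case_prod_unfold)
  then have e2: "(\<integral>z. D1 C' (snd z) (fst z) \<partial>(U \<Otimes>\<^sub>M U)) = 1 / 2"
    by (simp add: m[OF C'] integral_U_clip)
  define k where "k z = D1 C (fst z) (snd z) + D1 C' (snd z) (fst z) - h (fst z) (snd z)" for z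
  have ih: "integrable (U \<Otimes>\<^sub>M U) (\<lambda>z. h (fst z) (snd z))"
    by (rule integrable_UU_bounded[of _ 2]) (use h in auto)
  have k0: "0 \<le> k z" for z using sq[of C "fst z" "snd z"] sq[of C' "snd z" "fst z"] by (simp add: k_def h_def)
  have ik: "integrable (U \<Otimes>\<^sub>M U) k" unfolding k_def using i1 i2 ih by auto
  have "integral\<^sup>L (U \<Otimes>\<^sub>M U) k \<le> 0"
    unfolding k_def using ge e1 e2 i1 i2 ih by simp
  moreover have "0 \<le> integral\<^sup>L (U \<Otimes>\<^sub>M U) k" using k0 by simp
  ultimately have "AE z in U \<Otimes>\<^sub>M U. k z = 0"
    using integral_nonneg_eq_0_iff_AE[OF ik] k0 by simp
  then show ?thesis
  proof eventually_elim
    case (elim z)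
    have "(D1 C (fst z) (snd z))\<^sup>2 = D1 C (fst z) (snd z)" "(D1 C' (snd z) (fst z))\<^sup>2 = D1 C' (snd z) (fst z)"
      using elim sq[of C "fst z" "snd z"] sq[of C' "snd z" "fst z"] unfolding k_def h_def by linarith+
    moreover have "a \<in> {0, 1}" if "a\<^sup>2 = a" for a :: real
      using that by (simp add: power2_eq_square)
    ultimately show ?case unfolding C'_def by blast
  qed
qed

section \<open>The graph on which the first derivative jumps\<close>

text \<open>If \<open>h\<close> vanishes at \<open>y\<close>, it vanishes almost everywhere on \<open>[0, y]\<close>, so the zero set has measure at least
\<open>y\<close>; if \<open>h\<close> is \<open>1\<close> at \<open>y\<close>, the zero set is essentially contained in \<open>[0, y]\<close>. The set \<open>W\<close> collects the points at
which the behaviour of \<open>h\<close> is under control.\<close>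

lemma zero_one_monotone_threshold:
  fixes h :: "real \<Rightarrow> real"
  assumes hm: "h \<in> borel_measurable borel" and range: "\<And>y. 0 \<le> h y" "\<And>y. h y \<le> 1"
    and W: "AE y in U. y \<in> W"
    and zo: "\<And>y. y \<in> W \<Longrightarrow> h y \<in> {0, 1}"
    and mono: "\<And>y y'. y \<in> W \<Longrightarrow> y' \<in> W \<Longrightarrow> y \<le> y' \<Longrightarrow> h y \<le> h y'"
    and y: "y \<in> W" "y \<in> {0..1}"
  shows "(\<integral>t. 1 - h t \<partial>U) < y \<Longrightarrow> h y = 1" "y < (\<integral>t. 1 - h t \<partial>U) \<Longrightarrow> h y = 0"
proof -
  note [measurable] = hm
  have int: "integrable U (\<lambda>t. 1 - h t)"
    by (rule integrable_U_bounded[of _ 1]) (use range in auto)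
  have m: "measure U {a..b} = b - a" if "0 \<le> a" "a \<le> b" "b \<le> 1" for a b
    using that by (simp add: measure_def emeasure_U Int_absorb1)
  have "y \<le> (\<integral>t. 1 - h t \<partial>U)" if "h y = 0"
  proof -
    have "y = (\<integral>t. indicator {0..y} t \<partial>U)" using m[of 0 y] y by simp
    also have "\<dots> \<le> (\<integral>t. 1 - h t \<partial>U)"
    proof (rule integral_mono_AE[OF _ int])
      show "AE t in U. indicator {0..y} t \<le> 1 - h t"
        using W
      proof eventually_elim
        case (elim t)
        then show ?case
          using mono[OF elim y(1)] that range[of t] zo[OF elim] by (auto simp: indicator_def)
      qed
      show "integrable U (indicator {0..y} :: real \<Rightarrow> real)"
        by (rule integrable_U_bounded[of _ 1]) (auto simp: indicator_def)
    qed
    finally show ?thesis .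
  qed
  then show "h y = 1" if "(\<integral>t. 1 - h t \<partial>U) < y" using that zo[OF y(1)] by auto
  have "(\<integral>t. 1 - h t \<partial>U) \<le> y" if "h y = 1"
  proof -
    have "(\<integral>t. 1 - h t \<partial>U) \<le> (\<integral>t. indicator {0..y} t \<partial>U)"
    proof (rule integral_mono_AE[OF int])
      have "AE t in U. t \<in> {0..1}" by (simp add: AE_U)
      with W show "AE t in U. 1 - h t \<le> indicator {0..y} t"
      proof eventually_elim
        case (elim t)
        then show ?case
          using mono[OF y(1) elim(1)] that range[of t] by (auto simp: indicator_def)
      qed
      show "integrable U (indicator {0..y} :: real \<Rightarrow> real)"
        by (rule integrable_U_bounded[of _ 1]) (auto simp: indicator_def)
    qed
    also have "\<dots> = y" using m[of 0 y] y by simp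
    finally show ?thesis .
  qed
  then show "h y = 0" if "y < (\<integral>t. 1 - h t \<partial>U)" using that zo[OF y(1)] by auto
qed

lemma AE_U_interval:
  assumes P: "AE y in U. P y" and ab: "0 \<le> a" "a < b" "b \<le> 1"
  shows "\<exists>y. a < y \<and> y < b \<and> P y"
proof (rule ccontr)
  assume "\<not> ?thesis"
  with P ab have "AE y in lborel. y \<notin> {a<..<b}"
    unfolding AE_U by (auto elim!: eventually_mono)
  then have "emeasure lborel {a<..<b} = 0"
    by (subst (asm) AE_iff_null_sets[symmetric]) auto
  with ab show False by simp
qed

text \<open>For a 0-1-valued derivative this is the measure of its zero set in \<open>y\<close>, which is the place of its jump.\<close>

definition threshold :: "(real \<Rightarrow> real \<Rightarrow> real) \<Rightarrow> real \<Rightarrow> real" where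
  "threshold C x = (\<integral>y. 1 - D1 C x y \<partial>U)"

lemma threshold_measurable:
  assumes C: "copula C"
  shows "threshold C \<in> borel_measurable borel"
proof -
  have "(\<lambda>z. D1 C (fst z) (snd z)) \<in> borel_measurable (borel \<Otimes>\<^sub>M U)"
    by (intro D1_measurable[OF C]) measurable
  then have "(\<lambda>x. \<integral>y. 1 - D1 C x y \<partial>U) \<in> borel_measurable borel"
    by (intro U.borel_measurable_lebesgue_integral) (simp add: case_prod_unfold)
  then show ?thesis by (simp add: threshold_def[abs_def])
qed

lemma threshold_range:
  assumes C: "copula C"
  shows "threshold C x \<in> {0..1}"
proof -
  have [measurable]: "(\<lambda>y. D1 C x y) \<in> borel_measurable borel" by (intro D1_measurable[OF C]) auto
  have "0 \<le> (\<integral>y. 1 - D1 C x y \<partial>U)" using D1_range by (intro Bochner_Integration.integral_nonneg) auto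
  moreover have "(\<integral>y. 1 - D1 C x y \<partial>U) \<le> (\<integral>y. 1 \<partial>U)"
    using D1_range by (intro Bochner_Integration.integral_mono integrable_U_bounded[of _ 1]) auto
  ultimately show ?thesis using U.prob_space by (simp add: threshold_def)
qed

lemma AE_threshold:
  assumes C: "copula C" and zo: "AE z in U \<Otimes>\<^sub>M U. D1 C (fst z) (snd z) \<in> {0, 1}"
  shows "AE z in U \<Otimes>\<^sub>M U. z \<in> differentiable1 C \<and> snd z \<noteq> threshold C (fst z) \<and>
     D1 C (fst z) (snd z) = (if threshold C (fst z) < snd z then 1 else 0)"
proof -
  note [measurable] = threshold_measurable[OF C] differentiable1_borel[OF C]
  note [measurable (raw)] = D1_measurable[OF C]
  have dm[measurable]: "differentiable1 C \<in> sets (U \<Otimes>\<^sub>M U)" using differentiable1_borel[OF C] by simp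
  have "AE x in U. AE y in U. (x, y) \<in> differentiable1 C"
    unfolding AE_U using AE_AE_differentiable1[OF C] by (auto elim!: eventually_mono)
  then have "AE z in U \<Otimes>\<^sub>M U. z \<in> differentiable1 C"
    by (intro UU.AE_pair_measure) (auto simp: space_pair_measure)
  with zo have "AE z in U \<Otimes>\<^sub>M U. z \<in> differentiable1 C \<and> D1 C (fst z) (snd z) \<in> {0, 1}" by auto
  from UU.AE_pair[OF this]
  have "AE x in U. AE y in U. (x, y) \<in> differentiable1 C \<and> y \<noteq> threshold C x \<and>
     D1 C x y = (if threshold C x < y then 1 else 0)"
  proof eventually_elim
    case (elim x)
    define W where "W = {y. (x, y) \<in> differentiable1 C \<and> D1 C x y \<in> {0, 1}}"
    have W: "AE y in U. y \<in> W" using elim by (simp add: W_def)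
    have hm: "D1 C x \<in> borel_measurable borel"
      by (intro D1_measurable[OF C] borel_measurable_const measurable_ident_sets refl)
    have "AE y in lborel. y \<noteq> threshold C x" by (rule AE_lborel_singleton)
    then have "AE y in U. y \<noteq> threshold C x" unfolding AE_U by auto
    moreover have "AE y in U. y \<in> {0..1}" by (simp add: AE_U)
    ultimately show ?case using W
    proof eventually_elim
      case (elim y)
      note th = zero_one_monotone_threshold[OF hm D1_range W _ _ elim(3,2), folded threshold_def]
      have "D1 C x y = 1" if "threshold C x < y"
        by (rule th(1)[OF _ _ that]) (auto simp: W_def intro: D1_mono[OF C])
      moreover have "D1 C x y = 0" if "y < threshold C x"
        by (rule th(2)[OF _ _ that]) (auto simp: W_def intro: D1_mono[OF C])
      ultimately show ?case using elim by (auto simp: W_def)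
    qed
  qed
  then show ?thesis
  proof (intro UU.AE_pair_measure)
    show "{z \<in> space (U \<Otimes>\<^sub>M U). z \<in> differentiable1 C \<and> snd z \<noteq> threshold C (fst z) \<and>
       D1 C (fst z) (snd z) = (if threshold C (fst z) < snd z then 1 else 0)} \<in> sets (U \<Otimes>\<^sub>M U)"
      by measurable
  qed simp
qed

text \<open>For almost every \<open>y\<close> the derivative is, almost everywhere in \<open>s\<close>, the indicator of \<open>f s < y\<close>, and integration over \<open>[0, x]\<close>
gives the claim with a strict inequality. The remaining \<open>y\<close> are squeezed between good ones, using that \<open>C\<close> is
1-Lipschitz in \<open>y\<close>.\<close>

lemma measure_threshold:
  assumes C: "copula C" and zo: "AE z in U \<Otimes>\<^sub>M U. D1 C (fst z) (snd z) \<in> {0, 1}"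
  shows "measure U {s. s \<le> x \<and> threshold C s \<le> y} = extend C x y"
proof -
  note tm[measurable] = threshold_measurable[OF C] 
  note [measurable (raw)] = D1_measurable[OF C]
  let ?f = "threshold C"
  have "AE z in U \<Otimes>\<^sub>M U. D1 C (fst z) (snd z) = (if ?f (fst z) < snd z then 1 else 0)"
    using AE_threshold[OF assms] by (auto elim!: eventually_mono)
  from UU.AE_pair[OF this]
  have "AE x in U. AE y in U. D1 C x y = (if ?f x < y then 1 else 0)" by simp
  then have good: "AE y in U. AE x in U. D1 C x y = (if ?f x < y then 1 else 0)"
  proof (subst (asm) UU.AE_commute)
    show "{z \<in> space (U \<Otimes>\<^sub>M U). D1 C (fst z) (snd z) = (if ?f (fst z) < snd z then 1 else 0)} \<in> sets (U \<Otimes>\<^sub>M U)"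
      by measurable
  qed auto
  have strict: "measure U {s. s \<le> x \<and> ?f s < y} = extend C x y"
    if y: "AE x in U. D1 C x y = (if ?f x < y then 1 else 0)" and x: "x \<in> {0..1}" for x y
  proof -
    have "extend C x y = (LBINT s:{0..x}. D1 C s y)"
      using integral_D1[OF C, of 0 x y] x extend_0(1)[OF C, of 0 y] by simp
    also have "\<dots> = (\<integral>s. indicator ({0..1} \<inter> {s. s \<le> x \<and> ?f s < y}) s \<partial>lborel)"
      unfolding set_lebesgue_integral_def
    proof (rule integral_cong_AE)
      show "AE s in lborel. indicator {0..x} s *\<^sub>R D1 C s y = indicator ({0..1} \<inter> {s. s \<le> x \<and> ?f s < y}) s"
        using y[unfolded AE_U] by eventually_elim (use x in \<open>auto simp: indicator_def\<close>)
    qed measurable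
    also have "\<dots> = measure lborel ({0..1} \<inter> {s. s \<le> x \<and> ?f s < y})"
      by simp
    also have "\<dots> = measure U {s. s \<le> x \<and> ?f s < y}"
      by (simp add: measure_def emeasure_U)
    finally show ?thesis ..
  qed
  have meas: "{s. s \<le> x \<and> ?f s \<le> y} \<in> sets borel" "{s. s \<le> x \<and> ?f s < y} \<in> sets borel" for x y
  proof -
    have "{s \<in> space borel. s \<le> x \<and> ?f s \<le> y} \<in> sets borel" by measurable
    then show "{s. s \<le> x \<and> ?f s \<le> y} \<in> sets borel" by simp
    have "{s \<in> space borel. s \<le> x \<and> ?f s < y} \<in> sets borel" by measurable
    then show "{s. s \<le> x \<and> ?f s < y} \<in> sets borel" by simp
  qed
  have main: "measure U {s. s \<le> x \<and> ?f s \<le> y} = extend C x y" if x: "x \<in> {0..1}" and y: "y \<in> {0..1}" for x y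
  proof (rule antisym)
    show "measure U {s. s \<le> x \<and> ?f s \<le> y} \<le> extend C x y"
    proof (cases "y = 1")
      case True
      have "measure U {s. s \<le> x \<and> ?f s \<le> y} \<le> measure U {..x}"
        by (intro U.finite_measure_mono) auto
      also have "measure U {..x} = x"
      proof -
        have "{0..1} \<inter> {..x} = {0..x}" using x by auto
        then show ?thesis using x by (simp add: measure_def emeasure_U)
      qed
      finally show ?thesis using True x extend_1(2)[OF C, of 1 x] by (simp add: clip_id)
    next
      case False
      show ?thesis
      proof (rule field_le_epsilon)
        fix e :: real assume e: "0 < e"
        obtain y' where y': "y < y'" "y' < min 1 (y + e)"
          and g: "AE x in U. D1 C x y' = (if ?f x < y' then 1 else 0)"
          using AE_U_interval[OF good, of y "min 1 (y + e)"] False y e by auto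
        have "measure U {s. s \<le> x \<and> ?f s \<le> y} \<le> measure U {s. s \<le> x \<and> ?f s < y'}"
          using y' by (intro U.finite_measure_mono) (auto simp: meas)
        also have "\<dots> = extend C x y'" by (rule strict[OF g x])
        also have "\<dots> \<le> extend C x y + e" using extend_slope2[OF C, of y y' x] y' by auto
        finally show "measure U {s. s \<le> x \<and> ?f s \<le> y} \<le> extend C x y + e" .
      qed
    qed
    show "extend C x y \<le> measure U {s. s \<le> x \<and> ?f s \<le> y}"
    proof (cases "y = 0")
      case True
      then show ?thesis using extend_0(2)[OF C, of 0 x] by simp
    next
      case False
      show ?thesis
      proof (rule field_le_epsilon)
        fix e :: real assume e: "0 < e"
        obtain y' where y': "max 0 (y - e) < y'" "y' < y"
          and g: "AE x in U. D1 C x y' = (if ?f x < y' then 1 else 0)"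
          using AE_U_interval[OF good, of "max 0 (y - e)" y] False y e by auto
        have "extend C x y \<le> extend C x y' + e" using extend_slope2[OF C, of y' y x] y' by auto
        also have "extend C x y' = measure U {s. s \<le> x \<and> ?f s < y'}" by (rule strict[OF g x, symmetric])
        also have "\<dots> \<le> measure U {s. s \<le> x \<and> ?f s \<le> y}"
          using y' by (intro U.finite_measure_mono) (auto simp: meas)
        finally show "extend C x y \<le> measure U {s. s \<le> x \<and> ?f s \<le> y} + e" by simp
      qed
    qed
  qed
  have "measure U {s. s \<le> x \<and> ?f s \<le> y} = measure U {s. s \<le> clip x \<and> ?f s \<le> clip y}"
    if "0 \<le> x" "0 \<le> y"
  proof -
    have "{0..1} \<inter> {s. s \<le> x \<and> ?f s \<le> y} = {0..1} \<inter> {s. s \<le> clip x \<and> ?f s \<le> clip y}"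
      using threshold_range[OF C] that by (auto simp: clip_def)
    then show ?thesis by (simp add: measure_def emeasure_U meas)
  qed
  moreover have "measure U {s. s \<le> x \<and> ?f s \<le> y} = 0" "extend C x y = 0" if "x < 0 \<or> y < 0"
  proof -
    have "\<not> (s \<le> x \<and> ?f s \<le> y)" if "s \<in> {0..1}" for s
      using threshold_range[OF C, of s] that \<open>x < 0 \<or> y < 0\<close> by auto
    then have "{0..1} \<inter> {s. s \<le> x \<and> ?f s \<le> y} = {}" by blast
    then show "measure U {s. s \<le> x \<and> ?f s \<le> y} = 0" by (simp add: measure_def emeasure_U meas)
    show "extend C x y = 0" using extend_0[OF C] that by auto
  qed
  ultimately show ?thesis using main[OF clip_in clip_in, of x y]
    by (cases "x < 0 \<or> y < 0") (auto simp: extend_def clip_id[OF clip_in])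
qed

section \<open>Existence\<close>

text \<open>The lower left quadrants form an intersection-stable generator of the Borel sets of the plane.\<close>

lemma real_pair_measure_eqI_cdf:
  fixes M N :: "(real \<times> real) measure"
  assumes "sets M = sets borel" "sets N = sets borel" "finite_measure M"
    and cdf: "\<And>a b. emeasure M ({..a} \<times> {..b}) = emeasure N ({..a} \<times> {..b})"
  shows "M = N"
proof (rule measure_eqI_generator_eq[of "range (\<lambda>(a, b). {..a::real} \<times> {..b::real})" UNIV M N "\<lambda>n. {..real n} \<times> {..real n}"])
  have gen: "sets (borel :: (real \<times> real) measure) = sigma_sets UNIV (range (\<lambda>(a, b). {..a::real} \<times> {..b::real}))"
  proof -
    have "(\<lambda>a. {..a}) = (\<lambda>(a::real, b::real). {..a} \<times> {..b})"
      by (auto simp: fun_eq_iff less_eq_prod_def)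
    then have "(borel :: (real \<times> real) measure) = sigma UNIV (range (\<lambda>(a, b). {..a::real} \<times> {..b::real}))"
      by (subst borel_eq_atMost) simp
    also have "sets \<dots> = sigma_sets UNIV (range (\<lambda>(a, b). {..a::real} \<times> {..b::real}))"
      by (rule sets_measure_of) simp
    finally show ?thesis .
  qed
  show "Int_stable (range (\<lambda>(a, b). {..a::real} \<times> {..b::real}))"
  proof (rule Int_stableI)
    fix A B assume "A \<in> range (\<lambda>(a, b). {..a::real} \<times> {..b::real})" "B \<in> range (\<lambda>(a, b). {..a::real} \<times> {..b::real})"
    then obtain a b c d where "A = {..a} \<times> {..b}" "B = {..c} \<times> {..d}" by auto
    then have "A \<inter> B = (\<lambda>(a, b). {..a} \<times> {..b}) (min a c, min b d)" by auto
    then show "A \<inter> B \<in> range (\<lambda>(a, b). {..a::real} \<times> {..b::real})" by blast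
  qed
  show "sets M = sigma_sets UNIV (range (\<lambda>(a, b). {..a::real} \<times> {..b::real}))"
    "sets N = sigma_sets UNIV (range (\<lambda>(a, b). {..a::real} \<times> {..b::real}))"
    using assms(1,2) gen by auto
  show "emeasure M X = emeasure N X" if "X \<in> range (\<lambda>(a, b). {..a::real} \<times> {..b::real})" for X
    using that cdf by auto
  show "range (\<lambda>n. {..real n} \<times> {..real n}) \<subseteq> range (\<lambda>(a, b). {..a::real} \<times> {..b::real})"
    by auto
  show "(\<Union>n. {..real n} \<times> {..real n}) = UNIV"
  proof (intro set_eqI iffI UNIV_I)
    fix z :: "real \<times> real"
    obtain n where "max (fst z) (snd z) \<le> real n" using real_arch_simple by blast
    then show "z \<in> (\<Union>n. {..real n} \<times> {..real n})" by (cases z) auto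
  qed
  show "emeasure M ({..real n} \<times> {..real n}) \<noteq> \<infinity>" for n
    using finite_measure.emeasure_finite[OF assms(3)] by simp
qed auto

text \<open>Both sides have distribution function \<open>C\<close>.\<close>

lemma graph_law_eq:
  assumes C: "copula C"
    and zo: "AE z in U \<Otimes>\<^sub>M U. D1 C (fst z) (snd z) \<in> {0, 1}"
      "AE z in U \<Otimes>\<^sub>M U. D1 (\<lambda>x y. C y x) (fst z) (snd z) \<in> {0, 1}"
  defines "f \<equiv> threshold C" and "g \<equiv> threshold (\<lambda>x y. C y x)"
  shows "distr U (borel \<Otimes>\<^sub>M borel) (\<lambda>s. (s, f s)) = distr U (borel \<Otimes>\<^sub>M borel) (\<lambda>t. (g t, t))"
proof -
  have C': "copula (\<lambda>x y. C y x)" by (rule copula_swap[OF C])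
  have [measurable]: "f \<in> borel_measurable borel" "g \<in> borel_measurable borel"
    unfolding f_def g_def by (rule threshold_measurable[OF C] threshold_measurable[OF C'])+
  show ?thesis
  proof (rule real_pair_measure_eqI_cdf)
    show "finite_measure (distr U (borel \<Otimes>\<^sub>M borel) (\<lambda>s. (s, f s)))"
      by (rule U.finite_measure_distr) measurable
    fix a b :: real
    have "emeasure (distr U (borel \<Otimes>\<^sub>M borel) (\<lambda>s. (s, f s))) ({..a} \<times> {..b}) = emeasure U {s. s \<le> a \<and> f s \<le> b}"
      by (subst emeasure_distr) (auto intro!: arg_cong[where f="emeasure U"])
    also have "\<dots> = extend C a b"
      using measure_threshold[OF C zo(1), of a b] by (simp add: U.emeasure_eq_measure f_def)
    also have "\<dots> = emeasure U {t. t \<le> b \<and> g t \<le> a}"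
      using measure_threshold[OF C' zo(2), of b a] by (simp add: U.emeasure_eq_measure g_def extend_swap[of C])
    also have "\<dots> = emeasure (distr U (borel \<Otimes>\<^sub>M borel) (\<lambda>t. (g t, t))) ({..a} \<times> {..b})"
      by (subst emeasure_distr) (auto intro!: arg_cong[where f="emeasure U"])
    finally show "emeasure (distr U (borel \<Otimes>\<^sub>M borel) (\<lambda>s. (s, f s))) ({..a} \<times> {..b}) =
        emeasure (distr U (borel \<Otimes>\<^sub>M borel) (\<lambda>t. (g t, t))) ({..a} \<times> {..b})" .
  qed (simp_all add: borel_prod)
qed

text \<open>A Lebesgue measurable set is a Borel set up to a subset of a Borel null set, and preimages of Borel null sets are
null.\<close>

lemma measure_preserving_if_borel:
  assumes F[measurable]: "F \<in> borel_measurable borel" and F01: "\<And>x. x \<in> {0..1} \<Longrightarrow> F x \<in> {0..1}"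
    and law: "distr U borel F = U"
  shows "measure_preserving F"
proof -
  have em: "emeasure lborel (F -` A \<inter> {0..1}) = emeasure lborel (A \<inter> {0..1})" if "A \<in> sets borel" for A
  proof -
    have "emeasure U A = emeasure (distr U borel F) A" by (simp add: law)
    also have "\<dots> = emeasure U (F -` A)" using that by (simp add: emeasure_distr)
    finally show ?thesis using that measurable_sets[OF F that] by (simp add: emeasure_U Int_commute)
  qed
  have vm: "F -` A \<inter> {0..1} \<in> sets borel" if "A \<in> sets borel" for A
    using measurable_sets[OF F that] by auto
  have main: "F -` B \<inter> {0..1} \<in> sets lebesgue \<and>
      (B \<subseteq> {0..1} \<longrightarrow> emeasure lebesgue (F -` B \<inter> {0..1}) = emeasure lebesgue B)" if B: "B \<in> sets lebesgue" for B
  proof -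
    obtain S N N' where S: "S \<in> sets borel" and N: "N' \<in> null_sets lborel" "N \<subseteq> N'" and BSN: "B = S \<union> N"
      using B by (elim sets_completionE) auto
    have n1: "N \<in> null_sets lebesgue"
      using N by (metis null_sets_completion_subset null_sets_completionI)
    have "F -` N' \<inter> {0..1} \<in> null_sets lborel"
    proof (rule null_setsI)
      have "emeasure lborel (F -` N' \<inter> {0..1}) = emeasure lborel (N' \<inter> {0..1})"
        using N by (intro em) auto
      also have "\<dots> \<le> emeasure lborel N'" using N by (intro emeasure_mono) auto
      finally show "emeasure lborel (F -` N' \<inter> {0..1}) = 0" using N by auto
      show "F -` N' \<inter> {0..1} \<in> sets lborel" using vm N by auto
    qed
    then have n2: "F -` N \<inter> {0..1} \<in> null_sets lebesgue"
      using N by (intro null_sets_completion_subset[OF _ null_sets_completionI]) auto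
    have eq: "F -` B \<inter> {0..1} = (F -` S \<inter> {0..1}) \<union> (F -` N \<inter> {0..1})" by (auto simp: BSN)
    have S': "F -` S \<inter> {0..1} \<in> sets lebesgue" using vm[OF S] by simp
    show ?thesis
    proof (intro conjI impI)
      show "F -` B \<inter> {0..1} \<in> sets lebesgue" unfolding eq using S' n2 by auto
      assume B01: "B \<subseteq> {0..1}"
      then have "S \<inter> {0..1} = S" by (auto simp: BSN)
      then have "emeasure lborel (F -` S \<inter> {0..1}) = emeasure lborel S" using em[OF S] by simp
      then have "emeasure lebesgue (F -` S \<inter> {0..1}) = emeasure lebesgue S"
        using S vm[OF S] by (simp add: emeasure_completion)
      moreover have "emeasure lebesgue (F -` B \<inter> {0..1}) = emeasure lebesgue (F -` S \<inter> {0..1})"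
        unfolding eq by (rule emeasure_Un_null_set[OF S' n2])
      moreover have "emeasure lebesgue B = emeasure lebesgue S"
        unfolding BSN using S by (intro emeasure_Un_null_set n1) simp
      ultimately show "emeasure lebesgue (F -` B \<inter> {0..1}) = emeasure lebesgue B" by simp
    qed
  qed
  show ?thesis
    unfolding measure_preserving_def
  proof (intro conjI allI impI)
    show "F \<in> lebesgue_on {0..1} \<rightarrow>\<^sub>M lebesgue_on {0..1}"
    proof (rule measurableI)
      fix A assume "A \<in> sets (lebesgue_on {0..1::real})"
      then obtain B where B: "B \<in> sets lebesgue" "A = {0..1} \<inter> B" by (auto simp: sets_restrict_space)
      have "F -` A \<inter> {0..1} = F -` B \<inter> {0..1}" using F01 B by auto
      then show "F -` A \<inter> space (lebesgue_on {0..1}) \<in> sets (lebesgue_on {0..1})"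
        using main[OF B(1)] by (auto simp: sets_restrict_space intro!: image_eqI[of _ _ "F -` B \<inter> {0..1}"])
    qed (use F01 in auto)
  qed (use main in blast)
qed

lemma exists_representation:
  assumes C: "copula C" and norm: "sobolev_norm C = 1"
  shows "\<exists>F. represents F C"
proof -
  define C' where "C' = (\<lambda>x y. C y x)"
  have C': "copula C'" using copula_swap[OF C] by (simp add: C'_def)
  define f where "f = threshold C"
  define g where "g = threshold C'"
  have fm[measurable]: "f \<in> borel_measurable borel" and gm[measurable]: "g \<in> borel_measurable borel"
    unfolding f_def g_def by (rule threshold_measurable[OF C] threshold_measurable[OF C'])+
  have f01: "f x \<in> {0..1}" and g01: "g x \<in> {0..1}" for x
    unfolding f_def g_def by (rule threshold_range[OF C] threshold_range[OF C'])+
  have zo: "AE z in U \<Otimes>\<^sub>M U. D1 C (fst z) (snd z) \<in> {0, 1} \<and> D1 C' (snd z) (fst z) \<in> {0, 1}"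
    using unit_norm_imp_zero_one_derivatives[OF C norm] by (simp add: C'_def)
  then have zo1: "AE z in U \<Otimes>\<^sub>M U. D1 C (fst z) (snd z) \<in> {0, 1}" by (auto elim!: eventually_mono)
  have swap_AE: "AE z in U \<Otimes>\<^sub>M U. P (snd z) (fst z)" if "AE z in U \<Otimes>\<^sub>M U. P (fst z) (snd z)"
      and "{z \<in> space (U \<Otimes>\<^sub>M U). P (fst z) (snd z)} \<in> sets (U \<Otimes>\<^sub>M U)" for P
  proof -
    from that(1) have "AE z in distr (U \<Otimes>\<^sub>M U) (U \<Otimes>\<^sub>M U) (\<lambda>(x, y). (y, x)). P (fst z) (snd z)"
      by (subst UU.distr_pair_swap[symmetric])
    then show ?thesis
      unfolding AE_distr_iff[OF measurable_pair_swap' that(2)] by (simp add: case_prod_unfold)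
  qed
  have zo2: "AE z in U \<Otimes>\<^sub>M U. D1 C' (fst z) (snd z) \<in> {0, 1}"
  proof (rule swap_AE)
    note [measurable (raw)] = D1_measurable[OF C']
    show "AE z in U \<Otimes>\<^sub>M U. D1 C' (snd z) (fst z) \<in> {0, 1}" using zo by (auto elim!: eventually_mono)
    show "{z \<in> space (U \<Otimes>\<^sub>M U). D1 C' (snd z) (fst z) \<in> {0, 1}} \<in> sets (U \<Otimes>\<^sub>M U)" by measurable
  qed
  have law: "distr U (borel \<Otimes>\<^sub>M borel) (\<lambda>s. (s, f s)) = distr U (borel \<Otimes>\<^sub>M borel) (\<lambda>t. (g t, t))"
    using graph_law_eq[OF C zo1 zo2[unfolded C'_def]] by (simp add: f_def g_def C'_def)
  have pm: "(\<lambda>s. (s, f s)) \<in> U \<rightarrow>\<^sub>M borel \<Otimes>\<^sub>M borel" "(\<lambda>t. (g t, t)) \<in> U \<rightarrow>\<^sub>M borel \<Otimes>\<^sub>M borel"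
    by measurable
  \<comment> \<open>Applied to the graphs \<open>x = g y\<close> and \<open>y = f x\<close>, each of which trivially carries one of the two equal laws.\<close>
  have transfer_AE: "(AE s in U. P (s, f s)) \<longleftrightarrow> (AE t in U. P (g t, t))"
    if P: "{z \<in> space (borel \<Otimes>\<^sub>M borel). P z} \<in> sets (borel \<Otimes>\<^sub>M borel)" for P
    unfolding AE_distr_iff[OF pm(1) P, symmetric] AE_distr_iff[OF pm(2) P, symmetric] law ..
  have m1: "{z \<in> space (borel \<Otimes>\<^sub>M borel). g (snd z) = fst z} \<in> sets (borel \<Otimes>\<^sub>M (borel :: real measure))"
    by measurable
  have gf: "AE s in U. g (f s) = s"
    using transfer_AE[OF m1] by simp
  have m2: "{z \<in> space (borel \<Otimes>\<^sub>M borel). f (fst z) = snd z} \<in> sets (borel \<Otimes>\<^sub>M (borel :: real measure))"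
    by measurable
  have fg: "AE t in U. f (g t) = t"
    using transfer_AE[OF m2] by simp
  have law_f: "distr U borel f = U"
  proof -
    have "distr U borel f = distr (distr U (borel \<Otimes>\<^sub>M borel) (\<lambda>s. (s, f s))) borel snd"
      by (subst distr_distr) (auto simp: comp_def)
    also have "\<dots> = distr U borel (\<lambda>t. t)" unfolding law by (subst distr_distr) (auto simp: comp_def)
    also have "\<dots> = U" by (intro distr_id2) simp
    finally show ?thesis .
  qed
  have law_g: "distr U borel g = U"
  proof -
    have "distr U borel g = distr (distr U (borel \<Otimes>\<^sub>M borel) (\<lambda>t. (g t, t))) borel fst"
      by (subst distr_distr) (auto simp: comp_def)
    also have "\<dots> = distr U borel (\<lambda>t. t)" unfolding law[symmetric] by (subst distr_distr) (auto simp: comp_def)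
    also have "\<dots> = U" by (intro distr_id2) simp
    finally show ?thesis .
  qed
  have g_null: "{y \<in> {0..1}. g y \<in> N} \<in> null_sets lborel" if N: "N \<in> null_sets lborel" for N
  proof -
    have Nb: "N \<in> sets borel" using N by auto
    have "emeasure U (g -` N) = emeasure (distr U borel g) N" using Nb by (simp add: emeasure_distr)
    also have "\<dots> \<le> emeasure lborel N" unfolding law_g emeasure_U[OF Nb] using Nb by (intro emeasure_mono) auto
    also have "\<dots> = 0" using N by auto
    finally have "emeasure lborel ({0..1} \<inter> g -` N) = 0"
      using measurable_sets[OF gm Nb] by (simp add: emeasure_U)
    moreover have "{y \<in> {0..1}. g y \<in> N} = {0..1} \<inter> g -` N" by auto
    ultimately show ?thesis using measurable_sets[OF gm Nb] by (auto simp: null_sets_def)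
  qed
  obtain F G :: "real \<Rightarrow> real" where Fm[measurable]: "F \<in> borel_measurable borel" and Gm[measurable]: "G \<in> borel_measurable borel"
    and F: "\<And>x. x \<in> {0..1} \<Longrightarrow> F x \<in> {0..1} \<and> G (F x) = x"
    and G: "\<And>y. y \<in> {0..1} \<Longrightarrow> G y \<in> {0..1} \<and> F (G y) = y"
    and Ff: "AE x in lborel. x \<in> {0..1} \<longrightarrow> F x = f x"
    and Gg: "AE y in lborel. y \<in> {0..1} \<longrightarrow> G y = g y"
    by (rule ae_inverse_to_borel_bijection[OF fm gm f01 g01 gf[unfolded AE_U] fg[unfolded AE_U] g_null])
      (assumption, erule (1) that, blast+)
  have bij: "bij_betw F {0..1} {0..1}"
    by (rule bij_betw_byWitness[of _ G]) (use F G in auto)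
  have inv: "inv_into {0..1} F y = G y" if "y \<in> {0..1}" for y
    using bij that G[OF that] by (intro inv_into_f_eq) (auto simp: bij_betw_def)
  have "distr U borel F = distr U borel f"
    by (rule distr_cong_AE) (use Ff in \<open>auto simp: AE_U\<close>)
  then have law_F: "distr U borel F = U" using law_f by simp
  have mp: "measure_preserving F"
    by (rule measure_preserving_if_borel[OF Fm _ law_F]) (use F in auto)
  note [measurable] = differentiable1_borel[OF C] differentiable1_borel[OF C']
  note [measurable (raw)] = D1_measurable[OF C] D1_measurable[OF C']
  have d1: "AE z in U \<Otimes>\<^sub>M U. z \<in> differentiable1 C \<and> snd z \<noteq> f (fst z) \<and>
     D1 C (fst z) (snd z) = (if f (fst z) < snd z then 1 else 0)"
    using AE_threshold[OF C zo1] by (simp add: f_def)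
  have "AE z in U \<Otimes>\<^sub>M U. (fst z, snd z) \<in> differentiable1 C' \<and> snd z \<noteq> g (fst z) \<and>
     D1 C' (fst z) (snd z) = (if g (fst z) < snd z then 1 else 0)"
    using AE_threshold[OF C' zo2] by (simp add: g_def)
  then have d2: "AE z in U \<Otimes>\<^sub>M U. (snd z, fst z) \<in> differentiable1 C' \<and> fst z \<noteq> g (snd z) \<and>
     D1 C' (snd z) (fst z) = (if g (snd z) < fst z then 1 else 0)"
    by (rule swap_AE) measurable
  have "AE x in U. F x = f x" using Ff by (simp add: AE_U)
  moreover have "{z \<in> space (U \<Otimes>\<^sub>M U). F (fst z) = f (fst z)} \<in> sets (U \<Otimes>\<^sub>M U)"
    by measurable
  ultimately have eF: "AE z in U \<Otimes>\<^sub>M U. F (fst z) = f (fst z)"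
    by (intro UU.AE_pair_measure) auto
  have "AE y in U. G y = g y" using Gg by (simp add: AE_U)
  moreover have "{z \<in> space (U \<Otimes>\<^sub>M U). G (snd z) = g (snd z)} \<in> sets (U \<Otimes>\<^sub>M U)"
    by measurable
  ultimately have eG: "AE z in U \<Otimes>\<^sub>M U. G (snd z) = g (snd z)"
    by (intro UU.AE_pair_measure) auto
  have sq: "AE z in U \<Otimes>\<^sub>M U. fst z \<in> {0..1} \<and> snd z \<in> {0..1}"
    unfolding AE_UU by (rule AE_I2) (auto simp: space_restrict_space)
  have "AE (x, y) in lebesgue_on ({0..1} \<times> {0..1}).
        (y > F x \<longrightarrow> ((\<lambda>u. C u y) has_real_derivative 1) (at x within {0..1})) \<and>
        (y < F x \<longrightarrow> ((\<lambda>u. C u y) has_real_derivative 0) (at x within {0..1})) \<and>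
        (x > inv_into {0..1} F y \<longrightarrow> ((\<lambda>v. C x v) has_real_derivative 1) (at y within {0..1})) \<and>
        (x < inv_into {0..1} F y \<longrightarrow> ((\<lambda>v. C x v) has_real_derivative 0) (at y within {0..1}))"
    unfolding AE_UU[symmetric] using d1 d2 eF eG sq
  proof eventually_elim
    case (elim z)
    obtain x y where z: "z = (x, y)" by (cases z)
    with elim have xy: "x \<in> {0..1}" "y \<in> {0..1}" by auto
    have "((\<lambda>u. C u y) has_real_derivative D1 C x y) (at x within {0..1})"
      by (rule has_derivative_D1_within[OF C _ xy]) (use elim z in auto)
    moreover have "((\<lambda>v. C' v x) has_real_derivative D1 C' y x) (at y within {0..1})"
      by (rule has_derivative_D1_within[OF C' _ xy(2,1)]) (use elim z in auto)
    ultimately show ?case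
      using elim inv[OF xy(2)] by (auto simp: z C'_def split: if_splits)
  qed
  then show ?thesis
    unfolding represents_def using bij mp measurable_restrict_space1[OF Fm] by auto
qed

section \<open>Uniqueness\<close>

text \<open>By Fubini, for almost every \<open>x\<close> almost no \<open>y\<close> lies strictly between \<open>f x\<close> and \<open>g x\<close>, since there the same derivative
would be both \<open>1\<close> and \<open>0\<close>.\<close>

lemma represents_unique:
  assumes f: "represents f C" and g: "represents g C"
  shows "AE x in lebesgue_on {0..1}. g x = f x"
proof -
  have range: "f x \<in> {0..1}" "g x \<in> {0..1}" if "x \<in> {0..1}" for x
    using f g that unfolding represents_def by (auto dest: bij_betwE)
  have unique: "D = E" if "(h has_real_derivative D) (at x within {0..1})"
      "(h has_real_derivative E) (at x within {0..1})" "x \<in> {0..1}" for h D E and x :: real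
    using vector_derivative_unique_within_closed_interval[of 0 1 x h D E] that
    by (simp add: has_real_derivative_iff_has_vector_derivative)
  have AE: "AE z in U \<Otimes>\<^sub>M U. (snd z > h (fst z) \<longrightarrow> ((\<lambda>u. C u (snd z)) has_real_derivative 1) (at (fst z) within {0..1})) \<and>
        (snd z < h (fst z) \<longrightarrow> ((\<lambda>u. C u (snd z)) has_real_derivative 0) (at (fst z) within {0..1}))"
    if h: "represents h C" for h
    using h unfolding represents_def AE_UU by (auto simp: case_prod_unfold elim!: eventually_mono)
  have "AE x in U. x \<in> {0..1}" by (simp add: AE_U)
  with UU.AE_pair[OF AE[OF f]] UU.AE_pair[OF AE[OF g]]
  have "AE x in U. g x = f x"
  proof eventually_elim
    case (elim x)
    have *: "AE y in U. \<not> (f x < y \<and> y < g x) \<and> \<not> (g x < y \<and> y < f x)"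
      using elim(1,2)
    proof eventually_elim
      case (elim y)
      then show ?case using unique[OF _ _ \<open>x \<in> {0..1}\<close>, of "\<lambda>u. C u y" 1 0] by auto
    qed
    show ?case
    proof (rule ccontr)
      assume "g x \<noteq> f x"
      then consider "f x < g x" | "g x < f x" by linarith
      then show False
      proof cases
        case 1
        then show False using AE_U_interval[OF *, of "f x" "g x"] range[OF elim(3)] by auto
      next
        case 2
        then show False using AE_U_interval[OF *, of "g x" "f x"] range[OF elim(3)] by auto
      qed
    qed
  qed
  then have "AE x in lebesgue. x \<in> {0..1} \<longrightarrow> g x = f x"
    by (simp add: AE_U AE_completion_iff)
  then show ?thesis by (subst AE_restrict_space_iff) auto
qed

section \<open>Rigidity on intervals of continuity\<close>

text \<open>A continuous injection maps \<open>[a, b]\<close> onto the interval between \<open>f a\<close> and \<open>f b\<close>. By injectivity on the whole of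
\<open>[0, 1]\<close> the preimage of that interval is \<open>[a, b]\<close> again, so the two lengths agree.\<close>

lemma measure_preserving_isometry:
  assumes bij: "bij_betw f {0..1} {0..1}" and mp: "measure_preserving f"
    and I: "is_interval I" "I \<subseteq> {0..1}" and cont: "continuous_on I f"
    and ab: "a \<in> I" "b \<in> I" "a \<le> b"
  shows "\<bar>f b - f a\<bar> = b - a"
proof -
  have abI: "{a..b} \<subseteq> I" using mem_is_interval_1_I[OF I(1) ab(1,2)] by auto
  have inj: "inj_on f {a..b}" 
    using bij abI I(2) unfolding bij_betw_def by (blast intro: inj_on_subset)
  have cont': "continuous_on {a..b} f" using cont abI by (rule continuous_on_subset)
  define l u where "l = min (f a) (f b)" and "u = max (f a) (f b)"
  have img: "f ` {a..b} = {l..u}"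
  proof -
    have "closed_segment a b = {a..b}"
      using ab(3) by (simp add: closed_segment_eq_real_ivl)
    moreover have "closed_segment (f a) (f b) = {l..u}"
      by (simp add: closed_segment_eq_real_ivl l_def u_def min_def max_def)
    ultimately show ?thesis
      using continuous_injective_image_segment_1[of a b f] cont' inj by simp
  qed
  have vimage: "f -` {l..u} \<inter> {0..1} = {a..b}"
  proof -
    have "inj_on f {0..1}" using bij by (simp add: bij_betw_def)
    moreover have "{a..b} \<subseteq> {0..1}" using abI I(2) by (rule subset_trans)
    ultimately have "f -` (f ` {a..b}) \<inter> {0..1} = {a..b}"
      unfolding inj_on_def by blast
    then show ?thesis by (simp only: img)
  qed
  have "{l..u} \<in> sets lebesgue" by simp
  moreover have "{l..u} \<subseteq> {0..1}"
    using bij abI I(2) unfolding img[symmetric] bij_betw_def by blast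
  ultimately have "emeasure lebesgue {a..b} = emeasure lebesgue {l..u}"
    using mp unfolding measure_preserving_def by (metis vimage)
  then have "ennreal (b - a) = ennreal (u - l)"
    using ab by (simp add: l_def u_def)
  then have "b - a = u - l" using ab by (simp add: l_def u_def)
  then show ?thesis by (auto simp: l_def u_def)
qed

text \<open>Two distinct points fix the sign, and every other point is determined by its distances to them.\<close>

lemma isometry_has_derivative:
  fixes f :: "real \<Rightarrow> real"
  assumes iso: "\<And>a b. a \<in> I \<Longrightarrow> b \<in> I \<Longrightarrow> a \<le> b \<Longrightarrow> \<bar>f b - f a\<bar> = b - a"
  shows "\<exists>c\<in>{1, -1}. \<forall>x\<in>I. (f has_real_derivative c) (at x within I)"
proof -
  have "\<exists>c\<in>{1, -1::real}. \<forall>x\<in>I. \<forall>y\<in>I. f y - f x = c * (y - x)"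
  proof (cases "\<exists>a\<in>I. \<exists>b\<in>I. a < b")
    case False
    then have eq: "x = y" if "x \<in> I" "y \<in> I" for x y using that by (meson linorder_neqE)
    have "f y - f x = 1 * (y - x)" if "x \<in> I" "y \<in> I" for x y using eq[OF that] by simp
    then show ?thesis by blast
  next
    case True
    then obtain a b where ab: "a \<in> I" "b \<in> I" "a < b" by auto
    define c where "c = (f b - f a) / (b - a)"
    have c: "c \<in> {1, -1}" "f b - f a = c * (b - a)"
      using iso[OF ab(1,2)] ab(3) by (auto simp: c_def abs_if divide_simps split: if_splits)
    have *: "f x - f a = c * (x - a)" if x: "x \<in> I" for x
    proof -
      have "\<bar>f x - f a\<bar> = \<bar>x - a\<bar>" "\<bar>f x - f b\<bar> = \<bar>x - b\<bar>" 
        using iso[OF x ab(1)] iso[OF ab(1) x] iso[OF x ab(2)] iso[OF ab(2) x]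
        by (cases "x \<le> a"; cases "x \<le> b"; simp)+
      then show ?thesis using c ab(3) by (auto simp: abs_if split: if_splits)
    qed
    have "f y - f x = c * (y - x)" if "x \<in> I" "y \<in> I" for x y
    proof -
      have "f y - f x = (f y - f a) - (f x - f a)" by simp
      also have "\<dots> = c * (y - a) - c * (x - a)" using * that by simp
      finally show ?thesis by (simp add: algebra_simps)
    qed
    then show ?thesis using c(1) by blast
  qed
  then obtain c where c: "c \<in> {1, -1}" "\<And>x y. x \<in> I \<Longrightarrow> y \<in> I \<Longrightarrow> f y - f x = c * (y - x)" by blast
  have "(f has_real_derivative c) (at x within I)" if x: "x \<in> I" for x
  proof (rule has_field_derivative_transform_within[OF _ zero_less_one x])
    show "((\<lambda>y. f x + c * (y - x)) has_real_derivative c) (at x within I)"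
      by (auto intro!: derivative_eq_intros)
    show "f x + c * (y - x) = f y" if "y \<in> I" for y using c(2)[OF x that] by simp
  qed
  with c(1) show ?thesis by blast
qed

theorem theorem3p1:
  fixes C :: "real \<Rightarrow> real \<Rightarrow> real"
  assumes "copula C"
    and "sobolev_norm C = 1"
  shows "(\<exists>f. represents f C \<and>
            (\<forall>g. represents g C \<longrightarrow> (AE x in lebesgue_on {0..1}. g x = f x))) \<and>
         (\<forall>f I. represents f C \<and> is_interval I \<and> I \<subseteq> {0..1} \<and> continuous_on I f \<longrightarrow>
            (\<exists>c\<in>{1, -1}. \<forall>x\<in>I. (f has_real_derivative c) (at x within I)))"
proof (intro conjI allI impI)
  show "\<exists>f. represents f C \<and> (\<forall>g. represents g C \<longrightarrow> (AE x in lebesgue_on {0..1}. g x = f x))"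
    using exists_representation[OF assms] represents_unique by blast
  fix f I
  assume f: "represents f C \<and> is_interval I \<and> I \<subseteq> {0..1} \<and> continuous_on I f"
  then have "bij_betw f {0..1} {0..1}" "measure_preserving f" by (auto simp: represents_def)
  then show "\<exists>c\<in>{1, -1}. \<forall>x\<in>I. (f has_real_derivative c) (at x within I)"
    using f by (intro isometry_has_derivative measure_preserving_isometry) auto
qed

end
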